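(* Let $(M,g,J)$ be a connected almost Hermitian manifold of real dimension $2m\geq 6$ which satisfies the axiom of co-holomorphic $(2n+1)$-spheres for some integer $n$ with $1\leq n\leq m-1$, and let $\alpha:M\to\mathbb{R}$ be a function. Then $M$ has pointwise constant type $\alpha$ if and only if $M$ has pointwise constant anti-holomorphic sectional curvature $\alpha$.
   Context: An almost Hermitian manifold $(M,g,J)$ is a smooth manifold $M$ with an almost complex structure $J$ and a Riemannian metric $g$ such that $g(JX,JY)=g(X,Y)$ for all vector fields $X,Y$. Let $\nabla$ be the Levi-Civita connection. Curvature conventions: $R(X,Y)=\nabla_{[X,Y]}-[\nabla_X,\nabla_Y]$, $R(X,Y,Z,U)=g(R(X,Y)Z,U)$, and the sectional curvature of the plane spanned by orthonormal $X,Y$ is $K(X,Y)=R(X,Y,X,Y)$. A plane section (two-dimensional linear subspace) $\sigma\subset T_p(M)$ is anti-holomorphic if $J\sigma\perp\sigma$. $M$ has pointwise constant anti-holomorphic sectional curvature $\alpha$ if for every $p\in M$ the sectional curvature of every anti-holomorphic plane section of $T_p(M)$ equals $\alpha(p)$. Put $\lambda(X,Y)=R(X,Y,X,Y)-R(X,Y,JX,JY)$. $M$ is of constant type at $p\in M$ if for all $X\in T_p(M)$ one has $\lambda(X,Y)=\lambda(X,Z)$ whenever $Y,Z\in T_p(M)$ satisfy $g(X,Y)=g(JX,Y)=g(X,Z)=g(JX,Z)=0$ and $g(Y,Y)=g(Z,Z)$. $M$ has pointwise constant type if this holds at every $p\in M$; it has pointwise constant type $\alpha$ if, moreover, for every $p\in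 M$, $\lambda(X,Y)=\alpha(p)$ for all orthonormal $X,Y\in T_p(M)$ with $g(X,JY)=0$. A holomorphic $2n$-plane is a $2n$-dimensional linear subspace $V\subset T_p(M)$ with $JV=V$. A co-holomorphic $(2n+1)$-plane is a $(2n+1)$-dimensional linear subspace of $T_p(M)$ containing a holomorphic $2n$-plane. A submanifold $N$ of $M$ is totally umbilical if its second fundamental form $h$ satisfies $h(X,Y)=g(X,Y)\eta$ for all $X,Y$ tangent to $N$, where $\eta$ is the mean curvature vector field of $N$. Axiom of co-holomorphic $(2n+1)$-spheres (for a fixed $n$, $1\leq n\leq m-1$): for each point $p\in M$ and each co-holomorphic $(2n+1)$-plane $\sigma\subset T_p(M)$, there exists a $(2n+1)$-dimensional totally umbilical submanifold $N$ of $M$ such that $p\in N$ and $T_p(N)=\sigma$. *)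

theory Defs
  imports "HOL-Analysis.Analysis" "HOL-Library.Function_Algebras"
begin

section \<open>Functions as vectors\<close>

text \<open>Tangent vectors are represented by the operators on functions they induce; the pointwise
  real vector space structure makes \<^const>\<open>subspace\<close>, \<^const>\<open>span\<close> and \<^const>\<open>dim\<close> available
  for them.\<close>

instantiation "fun" :: (type, real_vector) real_vector
begin

definition scaleR_fun :: "real \<Rightarrow> ('a \<Rightarrow> 'b) \<Rightarrow> 'a \<Rightarrow> 'b"
  where "scaleR_fun r f = (\<lambda>x. r *\<^sub>R f x)"

instance
  by standard (simp_all add: scaleR_fun_def fun_eq_iff scaleR_add_right scaleR_add_left)

end

section \<open>Smooth manifolds\<close>

text \<open>\<open>Ck_on k S f\<close>: \<open>f\<close> is of class \<open>C\<^sup>k\<close> on the open set \<open>S\<close> of a Euclidean space.\<close>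

primrec Ck_on :: "nat \<Rightarrow> 'e::euclidean_space set \<Rightarrow> ('e \<Rightarrow> 'f::real_normed_vector) \<Rightarrow> bool"
  where
    "Ck_on 0 S f \<longleftrightarrow> continuous_on S f"
  | "Ck_on (Suc k) S f \<longleftrightarrow> (\<forall>x\<in>S. f differentiable (at x)) \<and>
       (\<forall>v. Ck_on k S (\<lambda>x. frechet_derivative f (at x) v))"

definition smooth_on :: "'e::euclidean_space set \<Rightarrow> ('e \<Rightarrow> 'f::real_normed_vector) \<Rightarrow> bool"
  where "smooth_on S f \<longleftrightarrow> (\<forall>k. Ck_on k S f)"

text \<open>A chart is a pair of a domain and a coordinate map; the coordinate map is only meaningful on
  the domain. The dimension of the manifold is the dimension of the model space \<open>'e\<close>.\<close>

type_synonym ('a, 'e) chart = "'a set \<times> ('a \<Rightarrow> 'e)"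

abbreviation chart_inv :: "('a, 'e) chart \<Rightarrow> 'e \<Rightarrow> 'a"
  where "chart_inv c \<equiv> inv_into (fst c) (snd c)"

definition is_chart :: "('a::topological_space, 'e::euclidean_space) chart \<Rightarrow> bool"
  where "is_chart c \<longleftrightarrow> open (fst c) \<and> open (snd c ` fst c) \<and>
    homeomorphism (fst c) (snd c ` fst c) (snd c) (chart_inv c)"

definition compatible :: "('a, 'e::euclidean_space) chart \<Rightarrow> ('a, 'e) chart \<Rightarrow> bool"
  where "compatible c d \<longleftrightarrow>
    smooth_on (snd c ` (fst c \<inter> fst d)) (snd d \<circ> chart_inv c) \<and>
    smooth_on (snd d ` (fst c \<inter> fst d)) (snd c \<circ> chart_inv d)"

definition smooth_manifold ::
  "('a::{t2_space, second_countable_topology}, 'e::euclidean_space) chart set \<Rightarrow> bool"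
  where "smooth_manifold A \<longleftrightarrow>
    (\<forall>c\<in>A. is_chart c) \<and> (\<Union>c\<in>A. fst c) = UNIV \<and> (\<forall>c\<in>A. \<forall>d\<in>A. compatible c d)"

text \<open>The atlas \<open>A\<close> need not be maximal; the following charts are those of the maximal atlas.\<close>

definition admissible_chart ::
  "('a::topological_space, 'e::euclidean_space) chart set \<Rightarrow> ('a, 'e) chart \<Rightarrow> bool"
  where "admissible_chart A c \<longleftrightarrow> is_chart c \<and> (\<forall>d\<in>A. compatible c d)"

definition smooth_function ::
  "('a::topological_space, 'e::euclidean_space) chart set \<Rightarrow> 'a set \<Rightarrow> ('a \<Rightarrow> real) \<Rightarrow> bool"
  where "smooth_function A W f \<longleftrightarrow>
    (\<forall>c\<in>A. smooth_on (snd c ` (fst c \<inter> W)) (f \<circ> chart_inv c))"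

definition smooth_near ::
  "('a::topological_space, 'e::euclidean_space) chart set \<Rightarrow> 'a \<Rightarrow> ('a \<Rightarrow> real) \<Rightarrow> bool"
  where "smooth_near A p f \<longleftrightarrow> (\<exists>W. open W \<and> p \<in> W \<and> smooth_function A W f)"

text \<open>Smoothness of a curve on a neighbourhood of the parameter value \<open>0\<close>.\<close>

definition smooth_curve ::
  "('a::topological_space, 'e::euclidean_space) chart set \<Rightarrow> (real \<Rightarrow> 'a) \<Rightarrow> bool"
  where "smooth_curve A \<gamma> \<longleftrightarrow> (\<exists>\<epsilon>>0. continuous_on {-\<epsilon><..<\<epsilon>} \<gamma> \<and>
    (\<forall>c\<in>A. smooth_on {t \<in> {-\<epsilon><..<\<epsilon>}. \<gamma> t \<in> fst c} (snd c \<circ> \<gamma>)))"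

text \<open>The velocity of a curve at parameter value \<open>0\<close> is the operator \<open>f \<mapsto> (f \<circ> \<gamma>)'(0)\<close> on functions
  that are smooth near the base point. Since HOL functions are total, the operator is given the
  value \<open>0\<close> on all other functions, so that equal derivations are equal operators.\<close>

type_synonym 'a tvec = "('a \<Rightarrow> real) \<Rightarrow> real"

definition velocity ::
  "('a::topological_space, 'e::euclidean_space) chart set \<Rightarrow> (real \<Rightarrow> 'a) \<Rightarrow> 'a tvec"
  where "velocity A \<gamma> = (\<lambda>f. if smooth_near A (\<gamma> 0) f then deriv (\<lambda>t. f (\<gamma> t)) 0 else 0)"

text \<open>Velocities at \<open>p\<close> of the smooth curves of the manifold that run in \<open>N\<close>. The tangent space of
  the manifold is obtained for \<open>N = UNIV\<close>.\<close>

definition tangent_space_within ::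
  "('a::topological_space, 'e::euclidean_space) chart set \<Rightarrow> 'a set \<Rightarrow> 'a \<Rightarrow> 'a tvec set"
  where "tangent_space_within A N p = {velocity A \<gamma> | \<gamma>.
    smooth_curve A \<gamma> \<and> \<gamma> 0 = p \<and> (\<forall>\<^sub>F t in nhds 0. \<gamma> t \<in> N)}"

abbreviation tangent_space ::
  "('a::topological_space, 'e::euclidean_space) chart set \<Rightarrow> 'a \<Rightarrow> 'a tvec set"
  where "tangent_space A p \<equiv> tangent_space_within A UNIV p"

definition smooth_vector_field ::
  "('a::topological_space, 'e::euclidean_space) chart set \<Rightarrow> 'a set \<Rightarrow> ('a \<Rightarrow> 'a tvec) \<Rightarrow> bool"
  where "smooth_vector_field A W X \<longleftrightarrow> (\<forall>p\<in>W. X p \<in> tangent_space A p) \<and>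
    (\<forall>V f. open V \<and> V \<subseteq> W \<and> smooth_function A V f \<longrightarrow> smooth_function A V (\<lambda>p. X p f))"

definition lie_bracket :: "('a::topological_space, 'e::euclidean_space) chart set \<Rightarrow>
    ('a \<Rightarrow> 'a tvec) \<Rightarrow> ('a \<Rightarrow> 'a tvec) \<Rightarrow> 'a \<Rightarrow> 'a tvec"
  where "lie_bracket A X Y p =
    (\<lambda>f. if smooth_near A p f then X p (\<lambda>q. Y q f) - Y p (\<lambda>q. X q f) else 0)"

section \<open>Almost Hermitian manifolds\<close>

type_synonym 'a metric = "'a \<Rightarrow> 'a tvec \<Rightarrow> 'a tvec \<Rightarrow> real"
type_synonym 'a endo_field = "'a \<Rightarrow> 'a tvec \<Rightarrow> 'a tvec"

definition riemannian_metric ::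
  "('a::topological_space, 'e::euclidean_space) chart set \<Rightarrow> 'a metric \<Rightarrow> bool"
  where "riemannian_metric A g \<longleftrightarrow>
    (\<forall>p. \<forall>x\<in>tangent_space A p. \<forall>y\<in>tangent_space A p. \<forall>z\<in>tangent_space A p. \<forall>c.
        g p (x + y) z = g p x z + g p y z \<and> g p (c *\<^sub>R x) z = c * g p x z) \<and>
    (\<forall>p. \<forall>x\<in>tangent_space A p. \<forall>y\<in>tangent_space A p. g p x y = g p y x) \<and>
    (\<forall>p. \<forall>x\<in>tangent_space A p. x \<noteq> 0 \<longrightarrow> g p x x > 0) \<and>
    (\<forall>W X Y. open W \<and> smooth_vector_field A W X \<and> smooth_vector_field A W Y \<longrightarrow>
        smooth_function A W (\<lambda>p. g p (X p) (Y p)))"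

definition almost_complex_structure ::
  "('a::topological_space, 'e::euclidean_space) chart set \<Rightarrow> 'a endo_field \<Rightarrow> bool"
  where "almost_complex_structure A J \<longleftrightarrow>
    (\<forall>p. \<forall>x\<in>tangent_space A p. J p x \<in> tangent_space A p \<and> J p (J p x) = - x) \<and>
    (\<forall>p. \<forall>x\<in>tangent_space A p. \<forall>y\<in>tangent_space A p. \<forall>c.
        J p (x + y) = J p x + J p y \<and> J p (c *\<^sub>R x) = c *\<^sub>R J p x) \<and>
    (\<forall>W X. open W \<and> smooth_vector_field A W X \<longrightarrow> smooth_vector_field A W (\<lambda>p. J p (X p)))"

definition almost_hermitian_manifold ::
  "('a::{t2_space, second_countable_topology}, 'e::euclidean_space) chart set \<Rightarrow>
    'a metric \<Rightarrow> 'a endo_field \<Rightarrow> bool"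
  where "almost_hermitian_manifold A g J \<longleftrightarrow>
    smooth_manifold A \<and> riemannian_metric A g \<and> almost_complex_structure A J \<and>
    (\<forall>p. \<forall>x\<in>tangent_space A p. \<forall>y\<in>tangent_space A p. g p (J p x) (J p y) = g p x y)"

section \<open>The Levi-Civita connection and its curvature\<close>

text \<open>\<open>D p v Y\<close> stands for the vector \<open>(\<nabla>\<^sub>v Y)(p)\<close>, where \<open>v\<close> is tangent at \<open>p\<close> and \<open>Y\<close> is a vector
  field defined and smooth on some open neighbourhood of \<open>p\<close>. A connection acts on local vector
  fields; since these are represented by total functions, independence of their values away
  from \<open>p\<close> is made explicit.\<close>

type_synonym 'a connection_op = "'a \<Rightarrow> 'a tvec \<Rightarrow> ('a \<Rightarrow> 'a tvec) \<Rightarrow> 'a tvec"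

definition affine_connection ::
  "('a::topological_space, 'e::euclidean_space) chart set \<Rightarrow> 'a connection_op \<Rightarrow> bool"
  where "affine_connection A D \<longleftrightarrow>
    (\<forall>W Y. open W \<and> smooth_vector_field A W Y \<longrightarrow>
      (\<forall>p\<in>W. \<forall>v\<in>tangent_space A p. D p v Y \<in> tangent_space A p) \<and>
      (\<forall>X. smooth_vector_field A W X \<longrightarrow> smooth_vector_field A W (\<lambda>p. D p (X p) Y)) \<and>
      (\<forall>p\<in>W. \<forall>u\<in>tangent_space A p. \<forall>v\<in>tangent_space A p. \<forall>c.
        D p (u + v) Y = D p u Y + D p v Y \<and> D p (c *\<^sub>R v) Y = c *\<^sub>R D p v Y) \<and>
      (\<forall>Z. smooth_vector_field A W Z \<longrightarrow> (\<forall>p\<in>W. \<forall>v\<in>tangent_space A p.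
        D p v (\<lambda>q. Y q + Z q) = D p v Y + D p v Z)) \<and>
      (\<forall>f. smooth_function A W f \<longrightarrow> (\<forall>p\<in>W. \<forall>v\<in>tangent_space A p.
        D p v (\<lambda>q. f q *\<^sub>R Y q) = v f *\<^sub>R Y p + f p *\<^sub>R D p v Y)) \<and>
      (\<forall>Z. (\<forall>q\<in>W. Z q = Y q) \<longrightarrow> (\<forall>p\<in>W. \<forall>v\<in>tangent_space A p. D p v Z = D p v Y)))"

definition levi_civita_connection ::
  "('a::topological_space, 'e::euclidean_space) chart set \<Rightarrow> 'a metric \<Rightarrow> 'a connection_op \<Rightarrow> bool"
  where "levi_civita_connection A g D \<longleftrightarrow> affine_connection A D \<and>
    (\<forall>W X Y p. open W \<and> p \<in> W \<and> smooth_vector_field A W X \<and> smooth_vector_field A W Y \<longrightarrow>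
      D p (X p) Y - D p (Y p) X = lie_bracket A X Y p) \<and>
    (\<forall>W Y Z p v. open W \<and> p \<in> W \<and> smooth_vector_field A W Y \<and> smooth_vector_field A W Z \<and>
      v \<in> tangent_space A p \<longrightarrow>
      v (\<lambda>q. g q (Y q) (Z q)) = g p (D p v Y) (Z p) + g p (Y p) (D p v Z))"

text \<open>Sign convention: \<open>R(X,Y) = \<nabla>\<^sub>[\<^sub>X\<^sub>,\<^sub>Y\<^sub>] - [\<nabla>\<^sub>X, \<nabla>\<^sub>Y]\<close>. As a tensor, \<open>R(x,y)z\<close> is the common value at
  \<open>p\<close> for all local smooth vector fields extending \<open>x\<close>, \<open>y\<close>, \<open>z\<close>.\<close>

definition curvature_field :: "('a::topological_space, 'e::euclidean_space) chart set \<Rightarrow>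
    'a connection_op \<Rightarrow> ('a \<Rightarrow> 'a tvec) \<Rightarrow> ('a \<Rightarrow> 'a tvec) \<Rightarrow> ('a \<Rightarrow> 'a tvec) \<Rightarrow> 'a \<Rightarrow> 'a tvec"
  where "curvature_field A D X Y Z p =
    D p (lie_bracket A X Y p) Z -
    (D p (X p) (\<lambda>q. D q (Y q) Z) - D p (Y p) (\<lambda>q. D q (X q) Z))"

definition curvature_operator :: "('a::topological_space, 'e::euclidean_space) chart set \<Rightarrow>
    'a connection_op \<Rightarrow> 'a \<Rightarrow> 'a tvec \<Rightarrow> 'a tvec \<Rightarrow> 'a tvec \<Rightarrow> 'a tvec"
  where "curvature_operator A D p x y z = (THE w. \<forall>W X Y Z. open W \<and> p \<in> W \<and>
    smooth_vector_field A W X \<and> smooth_vector_field A W Y \<and> smooth_vector_field A W Z \<and>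
    X p = x \<and> Y p = y \<and> Z p = z \<longrightarrow> w = curvature_field A D X Y Z p)"

definition curvature :: "('a::topological_space, 'e::euclidean_space) chart set \<Rightarrow> 'a metric \<Rightarrow>
    'a connection_op \<Rightarrow> 'a \<Rightarrow> 'a tvec \<Rightarrow> 'a tvec \<Rightarrow> 'a tvec \<Rightarrow> 'a tvec \<Rightarrow> real"
  where "curvature A g D p x y z u = g p (curvature_operator A D p x y z) u"

definition orthonormal_pair :: "'a metric \<Rightarrow> 'a \<Rightarrow> 'a tvec \<Rightarrow> 'a tvec \<Rightarrow> bool"
  where "orthonormal_pair g p x y \<longleftrightarrow> g p x x = 1 \<and> g p y y = 1 \<and> g p x y = 0"

definition plane_section ::
  "('a::topological_space, 'e::euclidean_space) chart set \<Rightarrow> 'a \<Rightarrow> 'a tvec set \<Rightarrow> bool"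
  where "plane_section A p \<sigma> \<longleftrightarrow> subspace \<sigma> \<and> \<sigma> \<subseteq> tangent_space A p \<and> dim \<sigma> = 2"

definition sectional_curvature :: "('a::topological_space, 'e::euclidean_space) chart set \<Rightarrow>
    'a metric \<Rightarrow> 'a connection_op \<Rightarrow> 'a \<Rightarrow> 'a tvec set \<Rightarrow> real"
  where "sectional_curvature A g D p \<sigma> = (THE k. \<forall>x\<in>\<sigma>. \<forall>y\<in>\<sigma>.
    orthonormal_pair g p x y \<longrightarrow> k = curvature A g D p x y x y)"

section \<open>Anti-holomorphic sectional curvature and constant type\<close>

definition anti_holomorphic :: "('a::topological_space, 'e::euclidean_space) chart set \<Rightarrow>
    'a metric \<Rightarrow> 'a endo_field \<Rightarrow> 'a \<Rightarrow> 'a tvec set \<Rightarrow> bool"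
  where "anti_holomorphic A g J p \<sigma> \<longleftrightarrow>
    plane_section A p \<sigma> \<and> (\<forall>x\<in>\<sigma>. \<forall>y\<in>\<sigma>. g p (J p x) y = 0)"

definition pointwise_constant_anti_holomorphic_curvature ::
  "('a::topological_space, 'e::euclidean_space) chart set \<Rightarrow> 'a metric \<Rightarrow> 'a endo_field \<Rightarrow>
    'a connection_op \<Rightarrow> ('a \<Rightarrow> real) \<Rightarrow> bool"
  where "pointwise_constant_anti_holomorphic_curvature A g J D \<alpha> \<longleftrightarrow>
    (\<forall>p \<sigma>. anti_holomorphic A g J p \<sigma> \<longrightarrow> sectional_curvature A g D p \<sigma> = \<alpha> p)"

definition type_function :: "('a::topological_space, 'e::euclidean_space) chart set \<Rightarrow>
    'a metric \<Rightarrow> 'a endo_field \<Rightarrow> 'a connection_op \<Rightarrow> 'a \<Rightarrow> 'a tvec \<Rightarrow> 'a tvec \<Rightarrow> real"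
  where "type_function A g J D p x y =
    curvature A g D p x y x y - curvature A g D p x y (J p x) (J p y)"

definition constant_type_at :: "('a::topological_space, 'e::euclidean_space) chart set \<Rightarrow>
    'a metric \<Rightarrow> 'a endo_field \<Rightarrow> 'a connection_op \<Rightarrow> 'a \<Rightarrow> bool"
  where "constant_type_at A g J D p \<longleftrightarrow>
    (\<forall>x\<in>tangent_space A p. \<forall>y\<in>tangent_space A p. \<forall>z\<in>tangent_space A p.
      g p x y = 0 \<and> g p (J p x) y = 0 \<and> g p x z = 0 \<and> g p (J p x) z = 0 \<and> g p y y = g p z z \<longrightarrow>
      type_function A g J D p x y = type_function A g J D p x z)"

definition pointwise_constant_type :: "('a::topological_space, 'e::euclidean_space) chart set \<Rightarrow>
    'a metric \<Rightarrow> 'a endo_field \<Rightarrow> 'a connection_op \<Rightarrow> ('a \<Rightarrow> real) \<Rightarrow> bool"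
  where "pointwise_constant_type A g J D \<alpha> \<longleftrightarrow>
    (\<forall>p. constant_type_at A g J D p \<and>
      (\<forall>x\<in>tangent_space A p. \<forall>y\<in>tangent_space A p.
        orthonormal_pair g p x y \<and> g p x (J p y) = 0 \<longrightarrow> type_function A g J D p x y = \<alpha> p))"

section \<open>Totally umbilical submanifolds\<close>

text \<open>Embedded submanifolds, by slice charts. An immersed submanifold is locally embedded, and the
  axiom below only asks for local data near a point, so it reads the same with either notion.\<close>

definition submanifold ::
  "('a::topological_space, 'e::euclidean_space) chart set \<Rightarrow> nat \<Rightarrow> 'a set \<Rightarrow> bool"
  where "submanifold A k N \<longleftrightarrow> (\<forall>p\<in>N. \<exists>c L. admissible_chart A c \<and> p \<in> fst c \<and>
    subspace L \<and> dim L = k \<and> snd c ` (fst c \<inter> N) = snd c ` fst c \<inter> L)"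

definition normal_part :: "('a::topological_space, 'e::euclidean_space) chart set \<Rightarrow>
    'a metric \<Rightarrow> 'a set \<Rightarrow> 'a \<Rightarrow> 'a tvec \<Rightarrow> 'a tvec"
  where "normal_part A g N p v = (THE w. w \<in> tangent_space A p \<and>
    (\<forall>z\<in>tangent_space_within A N p. g p w z = 0) \<and> v - w \<in> tangent_space_within A N p)"

text \<open>\<open>h(x,y)\<close> is the normal part of \<open>\<nabla>\<^sub>x Y\<close>, for any extension of \<open>y\<close> to a local vector field \<open>Y\<close> of
  the ambient manifold that is tangent to \<open>N\<close> along \<open>N\<close>.\<close>

definition second_fundamental_form :: "('a::topological_space, 'e::euclidean_space) chart set \<Rightarrow>
    'a metric \<Rightarrow> 'a connection_op \<Rightarrow> 'a set \<Rightarrow> 'a \<Rightarrow> 'a tvec \<Rightarrow> 'a tvec \<Rightarrow> 'a tvec"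
  where "second_fundamental_form A g D N p x y = (THE w. \<forall>W Y. open W \<and> p \<in> W \<and>
    smooth_vector_field A W Y \<and> (\<forall>q\<in>W \<inter> N. Y q \<in> tangent_space_within A N q) \<and> Y p = y \<longrightarrow>
    w = normal_part A g N p (D p x Y))"

definition orthonormal_basis :: "'a metric \<Rightarrow> 'a \<Rightarrow> 'a tvec set \<Rightarrow> 'a tvec set \<Rightarrow> bool"
  where "orthonormal_basis g p V B \<longleftrightarrow> finite B \<and> B \<subseteq> V \<and> span B = V \<and>
    (\<forall>x\<in>B. \<forall>y\<in>B. g p x y = (if x = y then 1 else 0))"

text \<open>The mean curvature vector is the trace of \<open>h\<close> divided by the dimension.\<close>

definition mean_curvature :: "('a::topological_space, 'e::euclidean_space) chart set \<Rightarrow>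
    'a metric \<Rightarrow> 'a connection_op \<Rightarrow> 'a set \<Rightarrow> 'a \<Rightarrow> 'a tvec"
  where "mean_curvature A g D N p = (THE \<eta>. \<forall>B.
    orthonormal_basis g p (tangent_space_within A N p) B \<longrightarrow>
    \<eta> = (1 / real (card B)) *\<^sub>R (\<Sum>e\<in>B. second_fundamental_form A g D N p e e))"

definition totally_umbilical :: "('a::topological_space, 'e::euclidean_space) chart set \<Rightarrow>
    'a metric \<Rightarrow> 'a connection_op \<Rightarrow> 'a set \<Rightarrow> bool"
  where "totally_umbilical A g D N \<longleftrightarrow>
    (\<forall>p\<in>N. \<forall>x\<in>tangent_space_within A N p. \<forall>y\<in>tangent_space_within A N p.
      second_fundamental_form A g D N p x y = g p x y *\<^sub>R mean_curvature A g D N p)"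

definition holomorphic_plane :: "('a::topological_space, 'e::euclidean_space) chart set \<Rightarrow>
    'a endo_field \<Rightarrow> nat \<Rightarrow> 'a \<Rightarrow> 'a tvec set \<Rightarrow> bool"
  where "holomorphic_plane A J n p V \<longleftrightarrow>
    subspace V \<and> V \<subseteq> tangent_space A p \<and> dim V = 2 * n \<and> J p ` V = V"

definition co_holomorphic_plane :: "('a::topological_space, 'e::euclidean_space) chart set \<Rightarrow>
    'a endo_field \<Rightarrow> nat \<Rightarrow> 'a \<Rightarrow> 'a tvec set \<Rightarrow> bool"
  where "co_holomorphic_plane A J n p \<sigma> \<longleftrightarrow>
    subspace \<sigma> \<and> \<sigma> \<subseteq> tangent_space A p \<and> dim \<sigma> = 2 * n + 1 \<and>
    (\<exists>V. holomorphic_plane A J n p V \<and> V \<subseteq> \<sigma>)"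

definition co_holomorphic_spheres_axiom ::
  "('a::topological_space, 'e::euclidean_space) chart set \<Rightarrow> 'a metric \<Rightarrow> 'a endo_field \<Rightarrow>
    'a connection_op \<Rightarrow> nat \<Rightarrow> bool"
  where "co_holomorphic_spheres_axiom A g J D n \<longleftrightarrow>
    (\<forall>p \<sigma>. co_holomorphic_plane A J n p \<sigma> \<longrightarrow>
      (\<exists>N. submanifold A (2 * n + 1) N \<and> totally_umbilical A g D N \<and>
        p \<in> N \<and> tangent_space_within A N p = \<sigma>))"

end

theory Submission
  imports Defs
begin

text \<open>If \<open>X, Y, Z\<close> are tangent to a totally umbilical submanifold \<open>N\<close> at \<open>p\<close> and \<open>Z\<close> is orthogonal to
  \<open>X\<close> and \<open>Y\<close>, then the Codazzi equation shows that \<open>R(X,Y)Z\<close> is tangent to \<open>N\<close>. Let \<open>X, Y\<close> be orthonormal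
  with \<open>g(X,JY) = 0\<close>. Since \<open>n \<le> m - 1\<close>, there is a holomorphic \<open>2n\<close>-plane \<open>V\<close> that contains \<open>X, JX\<close> and is
  orthogonal to \<open>Y, JY\<close>. The axiom applied to \<open>V \<oplus> \<real>Y\<close> gives such an \<open>N\<close> to which \<open>JY\<close> is normal,
  so \<open>R(X,Y,JX,JY) = 0\<close> and \<open>\<lambda>(X,Y)\<close> is the sectional curvature of the plane of \<open>X\<close> and \<open>Y\<close>. Constant
  type and constant anti-holomorphic sectional curvature are therefore the same condition.\<close>

section \<open>Calculus of smooth maps\<close>

text \<open>For a totally umbilical N with mean curvature \<eta>, the normal part of R(X,Y)Z is a
  combination of normal derivatives of \<eta> with coefficients g(X,Z) and g(Y,Z). Orthogonality of
  Z to X and Y removes exactly these derivatives, and Z = JX qualifies: it is orthogonal to X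
  always, and to Y because g(X,JY) = 0. Two obstacles shape the work. Curvature, normal part, second
  fundamental form and sectional curvature are given by definite descriptions, so independence of
  all choices has to precede any computation. And umbilicity is an identity along N only, so it may
  be differentiated only in directions tangent to N. Both are met in one slice chart: vectors are
  extended with constant components, which makes the extended fields commute and keeps them tangent
  to N, and a statement about normal parts becomes a family of scalar ones, one for each coordinate
  function vanishing on N. At the end, constant type speaks of vectors of any length, so the values
  on unit vectors have to be spread by homogeneity.\<close>

lemma Ck_on_subset: "Ck_on k S f \<Longrightarrow> T \<subseteq> S \<Longrightarrow> Ck_on k T f"
  by (induction k arbitrary: f) (auto intro: continuous_on_subset)

lemma frechet_derivative_cong_open:
  assumes "open S" "x \<in> S" "\<And>y. y \<in> S \<Longrightarrow> f y = h y" "f differentiable (at x)"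
  shows "h differentiable (at x)" "frechet_derivative h (at x) = frechet_derivative f (at x)"
proof -
  have "(f has_derivative frechet_derivative f (at x)) (at x)"
    using assms(4) frechet_derivative_works by blast
  then have *: "(h has_derivative frechet_derivative f (at x)) (at x)"
    using has_derivative_transform_within_open[OF _ assms(1,2)] assms(3) by blast
  then show "h differentiable (at x)" by (auto simp: differentiable_def)
  show "frechet_derivative h (at x) = frechet_derivative f (at x)"
    using frechet_derivative_at[OF *] by simp
qed

lemma Ck_on_cong:
  "open S \<Longrightarrow> (\<And>x. x \<in> S \<Longrightarrow> f x = h x) \<Longrightarrow> Ck_on k S f \<Longrightarrow> Ck_on k S h"
proof (induction k arbitrary: f h)
  case 0
  then show ?case by (auto intro: continuous_on_eq)
next
  case (Suc k)
  have d: "f differentiable (at x)" if "x \<in> S" for x using Suc.prems that by simp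
  note fd = frechet_derivative_cong_open[OF Suc.prems(1) _ Suc.prems(2) d]
  have "Ck_on k S (\<lambda>x. frechet_derivative h (at x) v)" for v
    by (rule Suc.IH[OF Suc.prems(1), of "\<lambda>x. frechet_derivative f (at x) v"])
      (use Suc.prems fd(2) in auto)
  then show ?case using fd(1) by simp
qed

lemma Ck_on_Suc_D: "Ck_on (Suc k) S f \<Longrightarrow> Ck_on k S f"
proof (induction k arbitrary: f)
  case 0
  then show ?case
    by (auto intro!: continuous_at_imp_continuous_on differentiable_imp_continuous_within)
qed auto

text \<open>Derivatives at interior points are unique, so an explicit formula \<open>f'\<close> may
  stand in for \<open>frechet_derivative f\<close>. The inductions below use it to supply the sum,
  product and chain rules.\<close>

lemma Ck_on_SucI:
  assumes "open S" "\<And>x. x \<in> S \<Longrightarrow> (f has_derivative f' x) (at x)"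
    and "\<And>v. Ck_on k S (\<lambda>x. f' x v)"
  shows "Ck_on (Suc k) S f"
proof -
  have "f' x = frechet_derivative f (at x)" if "x \<in> S" for x
    using assms(2)[OF that] frechet_derivative_at by blast
  then have "Ck_on k S (\<lambda>x. frechet_derivative f (at x) v)" for v
    using Ck_on_cong[OF assms(1) _ assms(3)[of v]] by simp
  then show ?thesis using assms(2) by (auto simp: differentiable_def)
qed

lemma Ck_on_SucD:
  assumes "Ck_on (Suc k) S f"
  shows "x \<in> S \<Longrightarrow> (f has_derivative frechet_derivative f (at x)) (at x)"
    and "Ck_on k S (\<lambda>x. frechet_derivative f (at x) v)"
    and "Ck_on k S f"
  using assms frechet_derivative_works Ck_on_Suc_D[OF assms] by auto

declare Ck_on.simps(2) [simp del]

lemma Ck_on_const: "open S \<Longrightarrow> Ck_on k S (\<lambda>x. c)"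
proof (induction k arbitrary: c)
  case (Suc k)
  show ?case
    by (rule Ck_on_SucI[where f' = "\<lambda>x v. 0"]) (use Suc in simp_all)
qed simp

lemma Ck_on_add:
  "open S \<Longrightarrow> Ck_on k S f \<Longrightarrow> Ck_on k S h \<Longrightarrow> Ck_on k S (\<lambda>x. f x + h x)"
proof (induction k arbitrary: f h)
  case (Suc k)
  note d = Ck_on_SucD[OF Suc.prems(2)] Ck_on_SucD[OF Suc.prems(3)]
  show ?case
  proof (rule Ck_on_SucI[OF Suc.prems(1)])
    show "((\<lambda>x. f x + h x) has_derivative (\<lambda>v. frechet_derivative f (at x) v +
      frechet_derivative h (at x) v)) (at x)" if "x \<in> S" for x
      using d(1)[OF that] d(4)[OF that] by (rule has_derivative_add)
    show "Ck_on k S (\<lambda>x. frechet_derivative f (at x) v + frechet_derivative h (at x) v)" for v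
      by (intro Suc.IH d(2,5) Suc.prems(1))
  qed
qed (auto intro: continuous_intros)

lemma Ck_on_sum:
  assumes "open S" "\<And>i. i \<in> I \<Longrightarrow> Ck_on k S (f i)"
  shows "Ck_on k S (\<lambda>x. \<Sum>i\<in>I. f i x)"
  using assms(2) by (induction I rule: infinite_finite_induct) (simp_all add: Ck_on_const Ck_on_add assms(1))

lemma Ck_on_bounded_linear:
  assumes "bounded_linear L" "open S"
  shows "Ck_on k S f \<Longrightarrow> Ck_on k S (\<lambda>x. L (f x))"
proof (induction k arbitrary: f)
  case 0
  then show ?case by (auto intro: bounded_linear.continuous_on[OF assms(1)])
next
  case (Suc k)
  note d = Ck_on_SucD[OF Suc.prems]
  show ?case
    by (rule Ck_on_SucI[OF assms(2) bounded_linear.has_derivative[OF assms(1) d(1)] Suc.IH[OF d(2)]])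
qed

lemma Ck_on_scaleR:
  fixes f :: "'e::euclidean_space \<Rightarrow> real"
  shows "open S \<Longrightarrow> Ck_on k S f \<Longrightarrow> Ck_on k S h \<Longrightarrow> Ck_on k S (\<lambda>x. f x *\<^sub>R h x)"
proof (induction k arbitrary: f h)
  case (Suc k)
  note d = Ck_on_SucD[OF Suc.prems(2)] Ck_on_SucD[OF Suc.prems(3)]
  show ?case
  proof (rule Ck_on_SucI[OF Suc.prems(1)])
    show "((\<lambda>x. f x *\<^sub>R h x) has_derivative (\<lambda>v. f x *\<^sub>R frechet_derivative h (at x) v +
      frechet_derivative f (at x) v *\<^sub>R h x)) (at x)" if "x \<in> S" for x
      using d(1)[OF that] d(4)[OF that] by (rule has_derivative_scaleR)
    show "Ck_on k S (\<lambda>x. f x *\<^sub>R frechet_derivative h (at x) v + frechet_derivative f (at x) v *\<^sub>R h x)" for v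
      by (intro Ck_on_add Suc.IH d(2,3,5,6) Suc.prems(1))
  qed
qed (auto intro: continuous_intros)

lemma Ck_on_comp:
  fixes f :: "'d::euclidean_space \<Rightarrow> 'e::euclidean_space"
  assumes "open S" "open T" "f ` S \<subseteq> T"
  shows "Ck_on k S f \<Longrightarrow> Ck_on k T h \<Longrightarrow> Ck_on k S (\<lambda>x. h (f x))"
proof (induction k arbitrary: h)
  case 0
  then show ?case using assms(3) by (simp add: continuous_on_compose2[of T h S f])
next
  case (Suc k)
  \<comment> \<open>\<open>Ck_on\<close> controls \<open>frechet_derivative h\<close> in fixed
    directions only. The direction \<open>frechet_derivative f (at x) v\<close> moves with x, so it
    is expanded over \<open>Basis\<close>.\<close>
  let ?f' = "\<lambda>x v. \<Sum>b\<in>Basis. (frechet_derivative f (at x) v \<bullet> b) *\<^sub>R frechet_derivative h (at (f x)) b"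
  note IH = Suc.IH[OF Ck_on_SucD(3)[OF Suc.prems(1)]]
  have "((\<lambda>x. h (f x)) has_derivative ?f' x) (at x)" if x: "x \<in> S" for x
  proof -
    have h: "(h has_derivative frechet_derivative h (at (f x))) (at (f x))"
      by (rule Ck_on_SucD(1)[OF Suc.prems(2)]) (use x assms(3) in blast)
    have *: "frechet_derivative h (at (f x)) v = (\<Sum>b\<in>Basis. (v \<bullet> b) *\<^sub>R frechet_derivative h (at (f x)) b)" for v
    proof -
      interpret l: linear "frechet_derivative h (at (f x))"
        by (rule has_derivative_linear[OF h])
      have "frechet_derivative h (at (f x)) v = frechet_derivative h (at (f x)) (\<Sum>b\<in>Basis. (v \<bullet> b) *\<^sub>R b)"
        by (simp add: euclidean_representation)
      also have "\<dots> = (\<Sum>b\<in>Basis. (v \<bullet> b) *\<^sub>R frechet_derivative h (at (f x)) b)"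
        by (simp only: l.sum l.scaleR)
      finally show ?thesis .
    qed
    have "frechet_derivative h (at (f x)) \<circ> frechet_derivative f (at x) = ?f' x"
      unfolding comp_def by (rule ext, rule *)
    moreover have "(h \<circ> f has_derivative frechet_derivative h (at (f x)) \<circ> frechet_derivative f (at x)) (at x)"
      using diff_chain_at[OF Ck_on_SucD(1)[OF Suc.prems(1) x] h] .
    ultimately show ?thesis by (simp add: comp_def)
  qed
  moreover have "Ck_on k S (\<lambda>x. ?f' x v)" for v
  proof (rule Ck_on_sum[OF assms(1)], rule Ck_on_scaleR[OF assms(1)])
    fix b :: 'e
    show "Ck_on k S (\<lambda>x. frechet_derivative f (at x) v \<bullet> b)"
      by (rule Ck_on_bounded_linear[OF bounded_linear_inner_left assms(1) Ck_on_SucD(2)[OF Suc.prems(1)]])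
    show "Ck_on k S (\<lambda>x. frechet_derivative h (at (f x)) b)"
      by (rule IH[OF Ck_on_SucD(2)[OF Suc.prems(2)]])
  qed
  ultimately show ?case by (rule Ck_on_SucI[OF assms(1)])
qed

text \<open>Continuity and derivatives are local, so when smoothness is checked the chart may be
  changed from point to point.\<close>

lemma Ck_on_locally:
  "(\<And>x. x \<in> S \<Longrightarrow> \<exists>T. open T \<and> x \<in> T \<and> Ck_on k T f) \<Longrightarrow> Ck_on k S f"
proof (induction k arbitrary: f)
  case 0
  have "continuous (at x within S) f" if "x \<in> S" for x
  proof -
    obtain T where "open T" "x \<in> T" "continuous_on T f" using 0[OF \<open>x \<in> S\<close>] by auto
    then show ?thesis using continuous_on_eq_continuous_at continuous_at_imp_continuous_at_within by blast
  qed
  then show ?case by (simp add: continuous_on_eq_continuous_within)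
next
  case (Suc k)
  have *: "(f has_derivative frechet_derivative f (at x)) (at x)"
      "\<exists>T. open T \<and> x \<in> T \<and> Ck_on k T (\<lambda>x. frechet_derivative f (at x) v)" if xS: "x \<in> S" for x v
  proof -
    obtain T where T: "open T" "x \<in> T" "Ck_on (Suc k) T f" using Suc.prems[OF xS] by blast
    show "(f has_derivative frechet_derivative f (at x)) (at x)"
      by (rule Ck_on_SucD(1)[OF T(3,2)])
    show "\<exists>T. open T \<and> x \<in> T \<and> Ck_on k T (\<lambda>x. frechet_derivative f (at x) v)"
      using T Ck_on_SucD(2)[OF T(3), of v] by blast
  qed
  have "Ck_on k S (\<lambda>x. frechet_derivative f (at x) v)" for v
    by (rule Suc.IH) (rule *(2))
  then show ?case using *(1) by (auto simp: Ck_on.simps(2) differentiable_def)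
qed

lemma smooth_on_subset: "smooth_on S f \<Longrightarrow> T \<subseteq> S \<Longrightarrow> smooth_on T f"
  using Ck_on_subset[of _ S f T] by (simp add: smooth_on_def)

lemma smooth_on_cong:
  "open S \<Longrightarrow> (\<And>x. x \<in> S \<Longrightarrow> f x = h x) \<Longrightarrow> smooth_on S f \<Longrightarrow> smooth_on S h"
  using Ck_on_cong[of S f h] by (simp add: smooth_on_def)

lemma smooth_on_locally:
  "(\<And>x. x \<in> S \<Longrightarrow> \<exists>T. open T \<and> x \<in> T \<and> smooth_on T f) \<Longrightarrow> smooth_on S f"
  unfolding smooth_on_def by (rule allI, rule Ck_on_locally) blast

lemma smooth_on_const: "open S \<Longrightarrow> smooth_on S (\<lambda>x. c)"
  by (simp add: smooth_on_def Ck_on_const)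

lemma smooth_on_add:
  "open S \<Longrightarrow> smooth_on S f \<Longrightarrow> smooth_on S h \<Longrightarrow> smooth_on S (\<lambda>x. f x + h x)"
  using Ck_on_add[of S _ f h] by (simp add: smooth_on_def)

lemma smooth_on_scaleR:
  fixes f :: "'e::euclidean_space \<Rightarrow> real"
  shows "open S \<Longrightarrow> smooth_on S f \<Longrightarrow> smooth_on S h \<Longrightarrow> smooth_on S (\<lambda>x. f x *\<^sub>R h x)"
  using Ck_on_scaleR[of S _ f h] by (simp add: smooth_on_def)

lemma smooth_on_bounded_linear:
  "bounded_linear L \<Longrightarrow> open S \<Longrightarrow> smooth_on S f \<Longrightarrow> smooth_on S (\<lambda>x. L (f x))"
  using Ck_on_bounded_linear[of L S _ f] by (simp add: smooth_on_def)

lemma smooth_on_comp: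
  fixes f :: "'d::euclidean_space \<Rightarrow> 'e::euclidean_space"
  shows "open S \<Longrightarrow> open T \<Longrightarrow> f ` S \<subseteq> T \<Longrightarrow> smooth_on S f \<Longrightarrow> smooth_on T h \<Longrightarrow> smooth_on S (\<lambda>x. h (f x))"
  using Ck_on_comp[of S T f _ h] by (simp add: smooth_on_def)

lemma smooth_on_id: "open S \<Longrightarrow> smooth_on S (\<lambda>x. x)"
  unfolding smooth_on_def
proof
  fix k assume "open S"
  then show "Ck_on k S (\<lambda>x. x)"
    using Ck_on_SucI[of S "\<lambda>x. x" "\<lambda>x v. v"] by (cases k) (simp_all add: Ck_on_const)
qed

lemma smooth_on_frechet_derivative:
  "smooth_on S f \<Longrightarrow> smooth_on S (\<lambda>x. frechet_derivative f (at x) v)"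
  using Ck_on_SucD(2)[of _ S f v] by (simp add: smooth_on_def)

lemma smooth_on_imp_differentiable: "smooth_on S f \<Longrightarrow> x \<in> S \<Longrightarrow> f differentiable (at x)"
  using Ck_on_SucD(1)[of 0 S f x] by (auto simp: smooth_on_def differentiable_def)

lemma smooth_on_has_derivative:
  "smooth_on S f \<Longrightarrow> x \<in> S \<Longrightarrow> (f has_derivative frechet_derivative f (at x)) (at x)"
  using smooth_on_imp_differentiable frechet_derivative_works by blast

section \<open>Charts and tangent spaces\<close>

definition coordf :: "('a, 'e::euclidean_space) chart \<Rightarrow> 'e \<Rightarrow> 'a \<Rightarrow> real"
  where "coordf c u = (\<lambda>r. snd c r \<bullet> u)"

text \<open>The tangent vector with components \<open>e\<close> in the chart. The value 0 on
  functions that are not smooth near q repeats the convention of \<open>velocity\<close>, so that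
  the two can be equal as operators.\<close>

definition coord_vec ::
  "('a::topological_space, 'e::euclidean_space) chart set \<Rightarrow> ('a, 'e) chart \<Rightarrow> 'a \<Rightarrow> 'e \<Rightarrow> 'a tvec"
  where "coord_vec A c q e = (\<lambda>f. if smooth_near A q f
    then frechet_derivative (f \<circ> chart_inv c) (at (snd c q)) e else 0)"

text \<open>A subspace is its own double orthogonal complement. This turns membership in the model
  space of a slice into linear equations, which can be differentiated along curves.\<close>

lemma subspace_eq_annihilator:
  fixes L :: "'e::euclidean_space set"
  assumes "subspace L" "\<And>u. (\<And>l. l \<in> L \<Longrightarrow> l \<bullet> u = 0) \<Longrightarrow> x \<bullet> u = 0"
  shows "x \<in> L"
proof -
  have "x \<in> orthogonal_comp (orthogonal_comp L)"
    using assms(2) by (auto simp: orthogonal_comp_def orthogonal_def inner_commute)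
  then show ?thesis using assms(1) orthogonal_comp_self by blast
qed

lemma is_chartD:
  assumes "is_chart c"
  shows "open (fst c)" "open (snd c ` fst c)" "inj_on (snd c) (fst c)"
    and "q \<in> fst c \<Longrightarrow> chart_inv c (snd c q) = q"
    and "continuous_on (fst c) (snd c)" "continuous_on (snd c ` fst c) (chart_inv c)"
    and "open V \<Longrightarrow> V \<subseteq> fst c \<Longrightarrow> open (snd c ` V)"
proof -
  have h: "homeomorphism (fst c) (snd c ` fst c) (snd c) (chart_inv c)"
    using assms by (auto simp: is_chart_def)
  show o: "open (fst c)" "open (snd c ` fst c)" using assms by (auto simp: is_chart_def)
  show i: "q \<in> fst c \<Longrightarrow> chart_inv c (snd c q) = q" for q
    using h by (auto simp: homeomorphism_def)
  then show "inj_on (snd c) (fst c)" by (rule inj_on_inverseI)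
  show "continuous_on (fst c) (snd c)" "continuous_on (snd c ` fst c) (chart_inv c)"
    using h by (auto simp: homeomorphism_def)
  show "open (snd c ` V)" if "open V" "V \<subseteq> fst c"
  proof -
    have "openin (top_of_set (fst c)) V" using that o(1) by (simp add: openin_open_eq)
    then have "openin (top_of_set (snd c ` fst c)) (snd c ` V)"
      by (rule homeomorphism_imp_open_map[OF h])
    then show ?thesis using o(2) openin_open_eq by blast
  qed
qed

section \<open>Smooth functions and coordinate vectors in admissible charts\<close>

locale smooth_mfd =
  fixes A :: "('a::{t2_space, second_countable_topology}, 'e::euclidean_space) chart set"
  assumes smooth_manifold: "smooth_manifold A"
begin

lemma admissibleD:
  assumes "admissible_chart A c"
  shows "is_chart c"
    and "d \<in> A \<Longrightarrow> smooth_on (snd c ` (fst c \<inter> fst d)) (snd d \<circ> chart_inv c)"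
    and "d \<in> A \<Longrightarrow> smooth_on (snd d ` (fst c \<inter> fst d)) (snd c \<circ> chart_inv d)"
  using assms by (auto simp: admissible_chart_def compatible_def)

lemma atlas_admissible: "c \<in> A \<Longrightarrow> admissible_chart A c"
  using smooth_manifold by (auto simp: smooth_manifold_def admissible_chart_def)

lemma atlas_chart: "c \<in> A \<Longrightarrow> is_chart c"
  using smooth_manifold by (auto simp: smooth_manifold_def)

lemma atlas_cover: obtains c where "c \<in> A" "q \<in> fst c"
  using smooth_manifold unfolding smooth_manifold_def by blast

text \<open>\<open>smooth_function\<close> tests the charts of A only. Near each point the
  transition map to such a chart carries smoothness over to any chart of the maximal atlas, in
  particular to slice charts.\<close>

lemma smooth_function_chart:
  assumes f: "smooth_function A W f" and W: "open W" and c: "admissible_chart A c"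
  shows "smooth_on (snd c ` (fst c \<inter> W)) (f \<circ> chart_inv c)"
proof (rule smooth_on_locally)
  fix x assume "x \<in> snd c ` (fst c \<inter> W)"
  then obtain q where q: "q \<in> fst c" "q \<in> W" "x = snd c q" by auto
  obtain d where d: "d \<in> A" "q \<in> fst d" using atlas_cover .
  note cd = is_chartD[OF admissibleD(1)[OF c]] and dd = is_chartD[OF atlas_chart[OF d(1)]]
  let ?S = "snd c ` (fst c \<inter> fst d \<inter> W)" and ?T = "snd d ` (fst d \<inter> W)"
  have S: "open ?S" and T: "open ?T"
    by (rule cd(7) dd(7); use W cd(1) dd(1) in blast)+
  have sm: "smooth_on ?S (snd d \<circ> chart_inv c)"
    by (rule smooth_on_subset[OF admissibleD(2)[OF c d(1)]]) auto
  have "smooth_on ?T (f \<circ> chart_inv d)" using f d(1) unfolding smooth_function_def by blast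
  then have "smooth_on ?S (\<lambda>x. (f \<circ> chart_inv d) ((snd d \<circ> chart_inv c) x))"
    by (rule smooth_on_comp[OF S T _ sm, rotated]) (auto simp: cd(4))
  then have "smooth_on ?S (f \<circ> chart_inv c)"
    by (rule smooth_on_cong[OF S, rotated]) (auto simp: cd(4) dd(4))
  then show "\<exists>T. open T \<and> x \<in> T \<and> smooth_on T (f \<circ> chart_inv c)" using S q d by blast
qed

text \<open>Compatibility in the other direction: on an open part of its domain a single admissible
  chart decides smoothness.\<close>

lemma smooth_function_from_chart:
  assumes c: "admissible_chart A c" and V: "open V" "V \<subseteq> fst c"
    and h: "smooth_on (snd c ` V) (h \<circ> chart_inv c)"
  shows "smooth_function A V h"
  unfolding smooth_function_def
proof
  fix d assume d: "d \<in> A"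
  note cd = is_chartD[OF admissibleD(1)[OF c]] and dd = is_chartD[OF atlas_chart[OF d(1)]]
  let ?S = "snd d ` (fst d \<inter> V)" and ?T = "snd c ` V"
  have S: "open ?S" by (rule dd(7)) (use V dd(1) in auto)
  have T: "open ?T" by (rule cd(7)[OF V])
  have sm: "smooth_on ?S (snd c \<circ> chart_inv d)"
    by (rule smooth_on_subset[OF admissibleD(3)[OF c d(1)]]) (use V in auto)
  have "smooth_on ?S (\<lambda>x. (h \<circ> chart_inv c) ((snd c \<circ> chart_inv d) x))"
    by (rule smooth_on_comp[OF S T _ sm h]) (auto simp: dd(4))
  then show "smooth_on ?S (h \<circ> chart_inv d)"
    by (rule smooth_on_cong[OF S, rotated]) (use V in \<open>auto simp: cd(4) dd(4) subset_iff\<close>)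
qed

lemma open_chart_image_Int: "open W \<Longrightarrow> d \<in> A \<Longrightarrow> open (snd d ` (fst d \<inter> W))"
  using is_chartD(1,7)[OF atlas_chart] by (meson Int_lower1 open_Int)

lemma smooth_function_subset: "smooth_function A W f \<Longrightarrow> V \<subseteq> W \<Longrightarrow> smooth_function A V f"
  unfolding smooth_function_def by (meson Int_mono image_mono order_refl smooth_on_subset)

lemma smooth_function_cong:
  assumes "smooth_function A W f" "open W" "\<And>q. q \<in> W \<Longrightarrow> f q = h q"
  shows "smooth_function A W h"
  unfolding smooth_function_def
proof
  fix d assume d: "d \<in> A"
  show "smooth_on (snd d ` (fst d \<inter> W)) (h \<circ> chart_inv d)"
    by (rule smooth_on_cong[OF open_chart_image_Int[OF assms(2) d], of "f \<circ> chart_inv d"])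
      (use assms d is_chartD(4)[OF atlas_chart[OF d]] in \<open>auto simp: smooth_function_def\<close>)
qed

lemma smooth_function_const: "open W \<Longrightarrow> smooth_function A W (\<lambda>q. k)"
  using open_chart_image_Int by (auto simp: smooth_function_def comp_def intro: smooth_on_const)

lemma smooth_function_add:
  "open W \<Longrightarrow> smooth_function A W f \<Longrightarrow> smooth_function A W h \<Longrightarrow> smooth_function A W (\<lambda>q. f q + h q)"
  unfolding smooth_function_def comp_def using open_chart_image_Int smooth_on_add by blast

lemma smooth_function_mult:
  "open W \<Longrightarrow> smooth_function A W f \<Longrightarrow> smooth_function A W h \<Longrightarrow> smooth_function A W (\<lambda>q. f q * h q)"
  unfolding smooth_function_def comp_def real_scaleR_def[symmetric]
  using open_chart_image_Int smooth_on_scaleR by blast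

lemma smooth_function_coordf: 
  assumes c: "admissible_chart A c"
  shows "smooth_function A (fst c) (coordf c u)"
proof (rule smooth_function_from_chart[OF c])
  note cd = is_chartD[OF admissibleD(1)[OF c]]
  show "open (fst c)" by (rule cd)
  have "smooth_on (snd c ` fst c) (\<lambda>x. x \<bullet> u)"
    by (rule smooth_on_bounded_linear[OF bounded_linear_inner_left cd(2) smooth_on_id[OF cd(2)]])
  then show "smooth_on (snd c ` fst c) (coordf c u \<circ> chart_inv c)"
    by (rule smooth_on_cong[OF cd(2), rotated]) (simp add: coordf_def f_inv_into_f)
qed simp

lemma smooth_nearI: "smooth_function A W f \<Longrightarrow> open W \<Longrightarrow> q \<in> W \<Longrightarrow> smooth_near A q f"
  by (auto simp: smooth_near_def)

lemma smooth_near_coordf: "admissible_chart A c \<Longrightarrow> q \<in> fst c \<Longrightarrow> smooth_near A q (coordf c u)"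
  using smooth_function_coordf is_chartD(1) admissibleD(1) smooth_nearI by blast

lemma smooth_near_mult:
  assumes "smooth_near A q f" "smooth_near A q h"
  shows "smooth_near A q (\<lambda>r. f r * h r)"
proof -
  obtain V W where "open V" "q \<in> V" "smooth_function A V f" "open W" "q \<in> W" "smooth_function A W h"
    using assms by (auto simp: smooth_near_def)
  then show ?thesis
    by (intro smooth_nearI[of "V \<inter> W"] smooth_function_mult) (auto intro: smooth_function_subset)
qed

lemma smooth_near_has_derivative:
  assumes c: "admissible_chart A c" "q \<in> fst c" and f: "smooth_near A q f"
  shows "((f \<circ> chart_inv c) has_derivative (\<lambda>e. coord_vec A c q e f)) (at (snd c q))"
proof -
  obtain W where W: "open W" "q \<in> W" "smooth_function A W f" using f by (auto simp: smooth_near_def)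
  have "((f \<circ> chart_inv c) has_derivative frechet_derivative (f \<circ> chart_inv c) (at (snd c q))) (at (snd c q))"
    by (rule smooth_on_has_derivative[OF smooth_function_chart[OF W(3,1) c(1)]]) (use W c in auto)
  then show ?thesis using f by (simp add: coord_vec_def)
qed

lemma coord_vec_eqI:
  assumes c: "admissible_chart A c" "q \<in> fst c" and f: "smooth_near A q f"
    and d: "((f \<circ> chart_inv c) has_derivative F) (at (snd c q))"
  shows "coord_vec A c q e f = F e"
  using has_derivative_unique[OF smooth_near_has_derivative[OF c f] d] by (rule fun_cong)

lemma coord_vec_not_smooth: "\<not> smooth_near A q f \<Longrightarrow> coord_vec A c q e f = 0"
  by (simp add: coord_vec_def)

lemma linear_coord_vec:
  assumes c: "admissible_chart A c" "q \<in> fst c"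
  shows "linear (coord_vec A c q)"
proof -
  have "linear (\<lambda>e. coord_vec A c q e f)" for f
  proof (cases "smooth_near A q f")
    case True
    then show ?thesis using smooth_near_has_derivative[OF c] has_derivative_linear by blast
  next
    case False
    then show ?thesis by (simp add: coord_vec_not_smooth linear_iff)
  qed
  then show ?thesis by (simp add: linear_iff fun_eq_iff scaleR_fun_def)
qed

lemma coord_vec_coordf:
  assumes c: "admissible_chart A c" "q \<in> fst c"
  shows "coord_vec A c q e (coordf c u) = e \<bullet> u"
proof (rule coord_vec_eqI[OF c smooth_near_coordf[OF c]])
  note cd = is_chartD[OF admissibleD(1)[OF c(1)]]
  have "((\<lambda>x. x \<bullet> u) has_derivative (\<lambda>x. x \<bullet> u)) (at (snd c q))"
    by (rule bounded_linear_imp_has_derivative[OF bounded_linear_inner_left])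
  then show "((coordf c u \<circ> chart_inv c) has_derivative (\<lambda>x. x \<bullet> u)) (at (snd c q))"
    by (rule has_derivative_transform_within_open[OF _ cd(2)])
      (use c in \<open>auto simp: coordf_def f_inv_into_f\<close>)
qed

lemma coord_vec_mult:
  assumes c: "admissible_chart A c" "q \<in> fst c" and f: "smooth_near A q f" and h: "smooth_near A q h"
  shows "coord_vec A c q e (\<lambda>r. f r * h r) = coord_vec A c q e f * h q + f q * coord_vec A c q e h"
proof -
  note cd = is_chartD[OF admissibleD(1)[OF c(1)]]
  have "((\<lambda>x. (f \<circ> chart_inv c) x * (h \<circ> chart_inv c) x) has_derivative 
    (\<lambda>e. f q * coord_vec A c q e h + coord_vec A c q e f * h q)) (at (snd c q))"
    using has_derivative_mult[OF smooth_near_has_derivative[OF c f] smooth_near_has_derivative[OF c h]]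
      cd(4)[OF c(2)] by simp
  then have "((\<lambda>r. f r * h r) \<circ> chart_inv c has_derivative 
    (\<lambda>e. f q * coord_vec A c q e h + coord_vec A c q e f * h q)) (at (snd c q))"
    by (simp add: comp_def)
  from coord_vec_eqI[OF c smooth_near_mult[OF f h] this] show ?thesis by simp
qed

section \<open>Velocities of curves and tangent spaces\<close>

lemma smooth_curve_chart:
  assumes \<gamma>: "smooth_curve A \<gamma>" and c: "admissible_chart A c" "\<gamma> 0 \<in> fst c"
  obtains e S where "((snd c \<circ> \<gamma>) has_vector_derivative e) (at 0)"
    "open S" "0 \<in> S" "\<And>t. t \<in> S \<Longrightarrow> \<gamma> t \<in> fst c"
proof -
  obtain \<epsilon> :: real where \<epsilon>: "\<epsilon> > 0" "continuous_on {-\<epsilon><..<\<epsilon>} \<gamma>"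
    "\<And>d. d \<in> A \<Longrightarrow> smooth_on {t \<in> {-\<epsilon><..<\<epsilon>}. \<gamma> t \<in> fst d} (snd d \<circ> \<gamma>)"
    using \<gamma> by (auto simp: smooth_curve_def)
  \<comment> \<open>\<open>smooth_curve\<close> tests the charts of A only, so the derivative is
    taken in such a chart and then carried to \<open>c\<close> by the transition map.\<close>
  obtain d where d: "d \<in> A" "\<gamma> 0 \<in> fst d" using atlas_cover .
  note cd = is_chartD[OF admissibleD(1)[OF c(1)]] and dd = is_chartD[OF atlas_chart[OF d(1)]]
  define S where "S = {t \<in> {-\<epsilon><..<\<epsilon>}. \<gamma> t \<in> fst c \<inter> fst d}"
  have "S = {-\<epsilon><..<\<epsilon>} \<inter> \<gamma> -` (fst c \<inter> fst d)" by (auto simp: S_def)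
  then have S: "open S" "0 \<in> S"
    using continuous_open_preimage[OF \<epsilon>(2) _ open_Int[OF cd(1) dd(1)]] \<epsilon>(1) c d
    by auto
  have "smooth_on S (snd d \<circ> \<gamma>)"
    by (rule smooth_on_subset[OF \<epsilon>(3)[OF d(1)]]) (auto simp: S_def)
  then have d1: "((snd d \<circ> \<gamma>) has_derivative frechet_derivative (snd d \<circ> \<gamma>) (at 0)) (at 0)"
    using smooth_on_has_derivative S by blast
  have "((snd c \<circ> chart_inv d) has_derivative frechet_derivative (snd c \<circ> chart_inv d) (at (snd d (\<gamma> 0)))) (at (snd d (\<gamma> 0)))"
    by (rule smooth_on_has_derivative[OF admissibleD(3)[OF c(1) d(1)]]) (use c d in auto)
  then have "(((snd c \<circ> chart_inv d) \<circ> (snd d \<circ> \<gamma>)) has_derivative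
    (frechet_derivative (snd c \<circ> chart_inv d) (at (snd d (\<gamma> 0))) \<circ> frechet_derivative (snd d \<circ> \<gamma>) (at 0))) (at 0)"
    using diff_chain_at[OF d1] by simp
  then have "((snd c \<circ> \<gamma>) has_derivative
    (frechet_derivative (snd c \<circ> chart_inv d) (at (snd d (\<gamma> 0))) \<circ> frechet_derivative (snd d \<circ> \<gamma>) (at 0))) (at 0)"
    by (rule has_derivative_transform_within_open[OF _ S]) (auto simp: S_def dd(4))
  then have "(snd c \<circ> \<gamma>) differentiable (at 0)" by (auto simp: differentiable_def)
  then have "((snd c \<circ> \<gamma>) has_vector_derivative vector_derivative (snd c \<circ> \<gamma>) (at 0)) (at 0)"
    by (simp add: vector_derivative_works)
  then show ?thesis by (rule that[OF _ S]) (simp add: S_def)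
qed

lemma velocity_eq_coord_vec:
  assumes \<gamma>: "smooth_curve A \<gamma>" and c: "admissible_chart A c" "\<gamma> 0 \<in> fst c"
    and e: "((snd c \<circ> \<gamma>) has_vector_derivative e) (at 0)"
  shows "velocity A \<gamma> = coord_vec A c (\<gamma> 0) e"
proof
  fix f
  show "velocity A \<gamma> f = coord_vec A c (\<gamma> 0) e f"
  proof (cases "smooth_near A (\<gamma> 0) f")
    case False
    then show ?thesis by (simp add: velocity_def coord_vec_def)
  next
    case True
    note cd = is_chartD[OF admissibleD(1)[OF c(1)]]
    let ?F = "\<lambda>e. coord_vec A c (\<gamma> 0) e f"
    interpret l: linear "coord_vec A c (\<gamma> 0)" by (rule linear_coord_vec[OF c])
    obtain e' S where S: "open S" "0 \<in> S" "\<And>t. t \<in> S \<Longrightarrow> \<gamma> t \<in> fst c"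
      by (rule smooth_curve_chart[OF \<gamma> c]) (rule that)
    have 1: "((snd c \<circ> \<gamma>) has_derivative (\<lambda>t. t *\<^sub>R e)) (at 0)"
      using e by (simp add: has_vector_derivative_def)
    have "((f \<circ> chart_inv c) has_derivative ?F) (at ((snd c \<circ> \<gamma>) 0))"
      using smooth_near_has_derivative[OF c True] by simp
    from diff_chain_at[OF 1 this]
    have "((f \<circ> chart_inv c) \<circ> (snd c \<circ> \<gamma>) has_derivative (\<lambda>t. t * ?F e)) (at 0)"
      by (simp add: comp_def l.scaleR scaleR_fun_def)
    then have "((\<lambda>t. f (\<gamma> t)) has_derivative (\<lambda>t. t * ?F e)) (at 0)"
      by (rule has_derivative_transform_within_open[OF _ S(1,2)]) (auto simp: cd(4) S(3))
    then have "((\<lambda>t. f (\<gamma> t)) has_real_derivative ?F e) (at 0)"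
      by (simp add: has_field_derivative_def mult_commute_abs)
    then show ?thesis using True by (simp add: velocity_def DERIV_imp_deriv)
  qed
qed

text \<open>Coordinate lines realise every component vector, which is what makes the set of
  velocities a full linear image of the model space. Far from 0 the line may leave the image of the
  chart, where \<open>chart_inv c\<close> is arbitrary; \<open>smooth_curve\<close> concerns a
  neighbourhood of 0 only.\<close>

lemma smooth_curve_line:
  fixes e :: 'e
  assumes c: "admissible_chart A c" "q \<in> fst c"
  defines "\<gamma> \<equiv> \<lambda>t. chart_inv c (snd c q + t *\<^sub>R e)"
  shows "smooth_curve A \<gamma>" "\<gamma> 0 = q" "velocity A \<gamma> = coord_vec A c q e"
    and "\<forall>\<^sub>F t in nhds 0. \<gamma> t \<in> fst c \<and> snd c (\<gamma> t) = snd c q + t *\<^sub>R e"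
proof -
  note cd = is_chartD[OF admissibleD(1)[OF c(1)]]
  let ?l = "\<lambda>t::real. snd c q + t *\<^sub>R e"
  have cl: "continuous_on UNIV ?l" by (intro continuous_intros)
  have "open (?l -` (snd c ` fst c))" by (rule open_vimage[OF cd(2) cl])
  moreover have "0 \<in> ?l -` (snd c ` fst c)" using c by auto
  ultimately obtain \<epsilon> where \<epsilon>: "\<epsilon> > 0" "ball 0 \<epsilon> \<subseteq> ?l -` (snd c ` fst c)"
    using openE by blast
  have I: "?l t \<in> snd c ` fst c" if "t \<in> {-\<epsilon><..<\<epsilon>}" for t
    using \<epsilon>(2) that by (auto simp: dist_real_def subset_iff)
  have \<gamma>c: "\<gamma> t \<in> fst c" "snd c (\<gamma> t) = ?l t" if "t \<in> {-\<epsilon><..<\<epsilon>}" for t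
    using inv_into_into[OF I[OF that]] f_inv_into_f[OF I[OF that]] by (auto simp: \<gamma>_def)
  have cont: "continuous_on {-\<epsilon><..<\<epsilon>} \<gamma>"
    unfolding \<gamma>_def by (rule continuous_on_compose2[OF cd(6) continuous_on_subset[OF cl]]) (use I in auto)
  have sml: "smooth_on S ?l" if "open S" for S
    by (intro smooth_on_add smooth_on_const smooth_on_bounded_linear[OF bounded_linear_scaleR_left] smooth_on_id that)
  show sc: "smooth_curve A \<gamma>"
    unfolding smooth_curve_def
  proof (intro exI[of _ \<epsilon>] conjI ballI cont \<epsilon>(1))
    fix d assume d: "d \<in> A"
    note dd = is_chartD[OF atlas_chart[OF d]]
    let ?S = "{t \<in> {-\<epsilon><..<\<epsilon>}. \<gamma> t \<in> fst d}"
    have "?S = {-\<epsilon><..<\<epsilon>} \<inter> \<gamma> -` fst d" by auto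
    then have S: "open ?S" using continuous_open_preimage[OF cont _ dd(1)] by simp
    have "smooth_on ?S (\<lambda>t. (snd d \<circ> chart_inv c) (?l t))"
    proof (rule smooth_on_comp[OF S _ _ sml[OF S] admissibleD(2)[OF c(1) d]])
      show "open (snd c ` (fst c \<inter> fst d))" by (rule cd(7)) (use cd(1) dd(1) in auto)
      show "?l ` ?S \<subseteq> snd c ` (fst c \<inter> fst d)"
      proof (rule image_subsetI)
        fix t assume "t \<in> ?S"
        then have t: "t \<in> {-\<epsilon><..<\<epsilon>}" "\<gamma> t \<in> fst d" by auto
        show "?l t \<in> snd c ` (fst c \<inter> fst d)"
          using \<gamma>c[OF t(1)] t(2) by (simp flip: \<gamma>c(2)[OF t(1)])
      qed
    qed
    then show "smooth_on ?S (snd d \<circ> \<gamma>)" by (simp add: comp_def \<gamma>_def)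
  qed
  show \<gamma>0: "\<gamma> 0 = q" using c by (simp add: \<gamma>_def cd(4))
  show ev: "\<forall>\<^sub>F t in nhds 0. \<gamma> t \<in> fst c \<and> snd c (\<gamma> t) = ?l t"
    unfolding eventually_nhds by (rule exI[of _ "{-\<epsilon><..<\<epsilon>}"]) (use \<epsilon>(1) \<gamma>c in auto)
  have "(?l has_vector_derivative e) (at 0)"
    by (auto intro!: derivative_eq_intros simp: has_vector_derivative_def)
  then have "((snd c \<circ> \<gamma>) has_vector_derivative e) (at 0)"
    by (rule has_vector_derivative_transform_within_open[where S = "{-\<epsilon><..<\<epsilon>}"]) (use \<epsilon>(1) \<gamma>c in auto)
  then show "velocity A \<gamma> = coord_vec A c q e"
    using velocity_eq_coord_vec[OF sc c(1)] \<gamma>0 c(2) by simp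
qed

text \<open>A linear functional that kills \<open>L\<close> is constantly 0 along a curve in N, so
  it kills the derivative, which therefore lies in \<open>L\<close>. Conversely the coordinate line
  through a point of N in a direction of \<open>L\<close> stays in N for small parameters.\<close>

lemma tangent_space_within_slice:
  assumes c: "admissible_chart A c" "q \<in> fst c" and q: "q \<in> N"
    and L: "subspace L" "snd c ` (fst c \<inter> N) = snd c ` fst c \<inter> L"
  shows "tangent_space_within A N q = coord_vec A c q ` L"
proof (intro equalityI subsetI)
  note cd = is_chartD[OF admissibleD(1)[OF c(1)]]
  \<comment> \<open>The slice condition compares images under the chart; injectivity of the chart
    makes it a criterion for single points.\<close>
  have NL: "r \<in> N \<longleftrightarrow> snd c r \<in> L" if "r \<in> fst c" for r
  proof
    show "r \<in> N \<Longrightarrow> snd c r \<in> L" using L(2) that by blast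
    assume "snd c r \<in> L"
    then have "snd c r \<in> snd c ` (fst c \<inter> N)" using L(2) that by blast
    then show "r \<in> N" using inj_onD[OF cd(3)] that by blast
  qed
  fix v
  {
    assume "v \<in> tangent_space_within A N q"
    then obtain \<gamma> where \<gamma>: "v = velocity A \<gamma>" "smooth_curve A \<gamma>" "\<gamma> 0 = q" "\<forall>\<^sub>F t in nhds 0. \<gamma> t \<in> N"
      by (auto simp: tangent_space_within_def)
    have c0: "\<gamma> 0 \<in> fst c" using c \<gamma> by simp
    obtain e S where e: "((snd c \<circ> \<gamma>) has_vector_derivative e) (at 0)"
      "open S" "0 \<in> S" "\<And>t. t \<in> S \<Longrightarrow> \<gamma> t \<in> fst c"
      by (rule smooth_curve_chart[OF \<gamma>(2) c(1) c0]) (rule that)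
    obtain T where T: "open T" "0 \<in> T" "\<And>t. t \<in> T \<Longrightarrow> \<gamma> t \<in> N"
      using \<gamma>(4) by (auto simp: eventually_nhds)
    have "e \<in> L"
    proof (rule subspace_eq_annihilator[OF L(1)])
      fix u assume u: "\<And>l. l \<in> L \<Longrightarrow> l \<bullet> u = 0"
      have "((\<lambda>t. (snd c \<circ> \<gamma>) t \<bullet> u) has_vector_derivative e \<bullet> u) (at 0)"
        by (rule bounded_linear.has_vector_derivative[OF bounded_linear_inner_left e(1)])
      then have "((\<lambda>t. 0) has_vector_derivative e \<bullet> u) (at (0::real))"
        by (rule has_vector_derivative_transform_within_open[where S = "S \<inter> T"])
          (use e T NL u in auto)
      then show "e \<bullet> u = 0"
        by (rule vector_derivative_unique_at[OF _ has_vector_derivative_const])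
    qed
    then show "v \<in> coord_vec A c q ` L"
      using velocity_eq_coord_vec[OF \<gamma>(2) c(1) c0 e(1)] \<gamma> by blast
  }
  {
    assume "v \<in> coord_vec A c q ` L"
    then obtain e where e: "e \<in> L" "v = coord_vec A c q e" by blast
    note line = smooth_curve_line[OF c, where e = e]
    have "\<forall>\<^sub>F t in nhds 0. chart_inv c (snd c q + t *\<^sub>R e) \<in> N"
      using line(4)
      by eventually_elim (use NL e L(1) c q in \<open>auto intro!: subspace_add subspace_scale\<close>)
    then have "velocity A (\<lambda>t. chart_inv c (snd c q + t *\<^sub>R e)) \<in> tangent_space_within A N q"
      unfolding tangent_space_within_def using line(1,2) by blast
    then show "v \<in> tangent_space_within A N q"
      using line(3) e(2) by simp
  }
qed

lemma tangent_space_eq: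
  "admissible_chart A c \<Longrightarrow> q \<in> fst c \<Longrightarrow> tangent_space A q = range (coord_vec A c q)"
  using tangent_space_within_slice[of c q UNIV UNIV] by simp

end

section \<open>Vector fields and connections\<close>

context smooth_mfd
begin

lemma tangent_space_coord:
  assumes c: "admissible_chart A c" "q \<in> fst c" and v: "v \<in> tangent_space A q"
  shows "\<exists>e. v = coord_vec A c q e \<and> (\<forall>u. v (coordf c u) = e \<bullet> u)"
  using v coord_vec_coordf[OF c] unfolding tangent_space_eq[OF c] by blast

lemma tangent_space_eqI:
  assumes c: "admissible_chart A c" "q \<in> fst c" and v: "v \<in> tangent_space A q" "w \<in> tangent_space A q"
    and eq: "\<And>u. v (coordf c u) = w (coordf c u)"
  shows "v = w"
proof -
  obtain e where e: "v = coord_vec A c q e" "\<And>u. v (coordf c u) = e \<bullet> u"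
    using tangent_space_coord[OF c v(1)] by blast
  obtain e' where e': "w = coord_vec A c q e'" "\<And>u. w (coordf c u) = e' \<bullet> u"
    using tangent_space_coord[OF c v(2)] by blast
  have "e \<bullet> u = e' \<bullet> u" for u using e(2)[of u] e'(2)[of u] eq[of u] by simp
  then have "\<forall>u. e \<bullet> u = e' \<bullet> u" by blast
  then have "e = e'" by (rule iffD1[OF vector_eq_rdot])
  then show ?thesis using e e' by simp
qed

lemma tangent_space_expand:
  assumes c: "admissible_chart A c" "q \<in> fst c" and v: "v \<in> tangent_space A q"
  shows "v = (\<Sum>b\<in>Basis. v (coordf c b) *\<^sub>R coord_vec A c q b)"
proof -
  interpret l: linear "coord_vec A c q" by (rule linear_coord_vec[OF c])
  obtain e where e: "v = coord_vec A c q e" "\<And>u. v (coordf c u) = e \<bullet> u"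
    using tangent_space_coord[OF c v] by blast
  have "v = coord_vec A c q (\<Sum>b\<in>Basis. (e \<bullet> b) *\<^sub>R b)" using e(1) by (simp add: euclidean_representation)
  also have "\<dots> = (\<Sum>b\<in>Basis. v (coordf c b) *\<^sub>R coord_vec A c q b)"
    by (simp only: l.sum l.scaleR e(2))
  finally show ?thesis .
qed

lemma subspace_tangent_space: "subspace (tangent_space A q)"
proof -
  obtain c where c: "c \<in> A" "q \<in> fst c" using atlas_cover .
  show ?thesis
    unfolding tangent_space_eq[OF atlas_admissible[OF c(1)] c(2)]
    by (rule linear_subspace_image[OF linear_coord_vec[OF atlas_admissible[OF c(1)] c(2)] subspace_UNIV])
qed

lemma tangent_space_coord_ex:
  assumes "v \<in> tangent_space A q"
  obtains c e where "admissible_chart A c" "q \<in> fst c" "v = coord_vec A c q e"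
proof -
  obtain c where c: "c \<in> A" "q \<in> fst c" using atlas_cover .
  show ?thesis
    using tangent_space_coord[OF atlas_admissible[OF c(1)] c(2) assms] that[OF atlas_admissible[OF c(1)] c(2)]
    by blast
qed

section \<open>Tangent vectors as derivations\<close>

lemma tangent_mult:
  assumes "v \<in> tangent_space A q" "smooth_near A q f" "smooth_near A q h"
  shows "v (\<lambda>r. f r * h r) = v f * h q + f q * v h"
proof -
  obtain c e where c: "admissible_chart A c" "q \<in> fst c" "v = coord_vec A c q e"
    using tangent_space_coord_ex[OF assms(1)] .
  show ?thesis unfolding c(3) by (rule coord_vec_mult[OF c(1,2) assms(2,3)])
qed

lemma smooth_near_add:
  assumes "smooth_near A q f" "smooth_near A q h"
  shows "smooth_near A q (\<lambda>r. f r + h r)"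
proof -
  obtain V W where "open V" "q \<in> V" "smooth_function A V f" "open W" "q \<in> W" "smooth_function A W h"
    using assms by (auto simp: smooth_near_def)
  then show ?thesis
    by (intro smooth_nearI[of "V \<inter> W"] smooth_function_add) (auto intro: smooth_function_subset)
qed

lemma smooth_near_const: "smooth_near A q (\<lambda>r. k)"
  using smooth_function_const[of UNIV] by (intro smooth_nearI[of UNIV]) auto

lemma tangent_add:
  assumes "v \<in> tangent_space A q" "smooth_near A q f" "smooth_near A q h"
  shows "v (\<lambda>r. f r + h r) = v f + v h"
proof -
  obtain c e where c: "admissible_chart A c" "q \<in> fst c" "v = coord_vec A c q e"
    using tangent_space_coord_ex[OF assms(1)] .
  have "((\<lambda>r. f r + h r) \<circ> chart_inv c has_derivative
    (\<lambda>e. coord_vec A c q e f + coord_vec A c q e h)) (at (snd c q))"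
    using has_derivative_add[OF smooth_near_has_derivative[OF c(1,2) assms(2)]
      smooth_near_has_derivative[OF c(1,2) assms(3)]] by (simp add: comp_def)
  from coord_vec_eqI[OF c(1,2) smooth_near_add[OF assms(2,3)] this] show ?thesis by (simp add: c(3))
qed

lemma tangent_const:
  assumes "v \<in> tangent_space A q"
  shows "v (\<lambda>r. k) = 0"
proof -
  obtain c e where c: "admissible_chart A c" "q \<in> fst c" "v = coord_vec A c q e"
    using tangent_space_coord_ex[OF assms(1)] .
  have "((\<lambda>r. k) \<circ> chart_inv c has_derivative (\<lambda>e. 0)) (at (snd c q))"
    by (simp add: comp_def)
  from coord_vec_eqI[OF c(1,2) smooth_near_const this] show ?thesis by (simp add: c(3))
qed

text \<open>A vector tangent to N is the velocity of a curve in N and so sees only values on N. Both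
  functions have to be smooth near q, because \<open>velocity\<close> is 0 on all others. This is
  the means of differentiating identities that hold along N only.\<close>

lemma tangent_within_cong:
  assumes v: "v \<in> tangent_space_within A N q"
    and f: "smooth_near A q f" and h: "smooth_near A q h"
    and W: "open W" "q \<in> W" and eq: "\<And>r. r \<in> W \<Longrightarrow> r \<in> N \<Longrightarrow> f r = h r"
  shows "v f = v h"
proof -
  obtain \<gamma> where \<gamma>: "v = velocity A \<gamma>" "smooth_curve A \<gamma>" "\<gamma> 0 = q" "\<forall>\<^sub>F t in nhds 0. \<gamma> t \<in> N"
    using v by (auto simp: tangent_space_within_def)
  obtain \<epsilon> :: real where \<epsilon>: "\<epsilon> > 0" "continuous_on {-\<epsilon><..<\<epsilon>} \<gamma>"
    using \<gamma>(2) by (auto simp: smooth_curve_def)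
  have "open ({-\<epsilon><..<\<epsilon>} \<inter> \<gamma> -` W)" by (rule continuous_open_preimage[OF \<epsilon>(2) _ W(1)]) simp
  then have "\<forall>\<^sub>F t in nhds 0. \<gamma> t \<in> W"
    unfolding eventually_nhds
    by (intro exI[of _ "{-\<epsilon><..<\<epsilon>} \<inter> \<gamma> -` W"]) (use \<epsilon>(1) \<gamma>(3) W(2) in auto)
  with \<gamma>(4) have "\<forall>\<^sub>F t in nhds 0. f (\<gamma> t) = h (\<gamma> t)"
    by eventually_elim (rule eq)
  then have "deriv (\<lambda>t. f (\<gamma> t)) 0 = deriv (\<lambda>t. h (\<gamma> t)) 0"
    by (rule deriv_cong_ev) simp
  then show ?thesis using \<gamma> f h by (simp add: velocity_def)
qed

lemma tangent_within_subset: "tangent_space_within A N q \<subseteq> tangent_space A q"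
  by (auto simp: tangent_space_within_def)

section \<open>Smooth vector fields and tensoriality\<close>

abbreviation "svf \<equiv> smooth_vector_field A"
abbreviation "sf \<equiv> smooth_function A"

lemma svf_tangent: "svf W X \<Longrightarrow> q \<in> W \<Longrightarrow> X q \<in> tangent_space A q"
  by (simp add: smooth_vector_field_def)

lemma svf_apply: "svf W X \<Longrightarrow> open V \<Longrightarrow> V \<subseteq> W \<Longrightarrow> sf V f \<Longrightarrow> sf V (\<lambda>q. X q f)"
  by (simp add: smooth_vector_field_def)

lemma svf_subset: "svf W X \<Longrightarrow> V \<subseteq> W \<Longrightarrow> svf V X"
  by (auto simp: smooth_vector_field_def)

lemma svf_cong:
  assumes X: "svf W X" and eq: "\<And>q. q \<in> W \<Longrightarrow> X q = Y q"
  shows "svf W Y"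
  unfolding smooth_vector_field_def
proof (intro conjI ballI allI impI)
  show "Y q \<in> tangent_space A q" if "q \<in> W" for q using svf_tangent[OF X that] eq[OF that] by simp
  fix V f assume V: "open V \<and> V \<subseteq> W \<and> sf V f"
  show "sf V (\<lambda>q. Y q f)"
    by (rule smooth_function_cong[OF svf_apply[OF X, of V f]]) (use V eq in auto)
qed

lemma svf_add:
  assumes X: "svf W X" and Y: "svf W Y"
  shows "svf W (\<lambda>q. X q + Y q)"
  unfolding smooth_vector_field_def
proof (intro conjI ballI allI impI)
  show "X q + Y q \<in> tangent_space A q" if "q \<in> W" for q
    using svf_tangent[OF X that] svf_tangent[OF Y that] subspace_tangent_space by (rule subspace_add[rotated])
  fix V f assume V: "open V \<and> V \<subseteq> W \<and> sf V f"
  then show "sf V (\<lambda>q. (X q + Y q) f)"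
    using smooth_function_add[OF _ svf_apply[OF X, of V f] svf_apply[OF Y, of V f]] by simp
qed

lemma svf_scale:
  assumes h: "sf W h" and X: "svf W X"
  shows "svf W (\<lambda>q. h q *\<^sub>R X q)"
  unfolding smooth_vector_field_def
proof (intro conjI ballI allI impI)
  show "h q *\<^sub>R X q \<in> tangent_space A q" if "q \<in> W" for q
    using svf_tangent[OF X that] subspace_tangent_space by (rule subspace_scale[rotated])
  fix V f assume V: "open V \<and> V \<subseteq> W \<and> sf V f"
  then show "sf V (\<lambda>q. (h q *\<^sub>R X q) f)"
    using smooth_function_mult[OF _ smooth_function_subset[OF h, of V] svf_apply[OF X, of V f]]
    by (simp add: scaleR_fun_def)
qed

lemma smooth_near_svf_apply:
  assumes X: "svf W X" "open W" "q \<in> W" and f: "smooth_near A q f"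
  shows "smooth_near A q (\<lambda>r. X r f)"
proof -
  obtain V where V: "open V" "q \<in> V" "sf V f" using f by (auto simp: smooth_near_def)
  have "sf (V \<inter> W) (\<lambda>r. X r f)"
    by (rule svf_apply[OF X(1)]) (use V X in \<open>auto intro: smooth_function_subset\<close>)
  then show ?thesis by (rule smooth_nearI) (use V X in auto)
qed

lemma svf_coord_vec:
  assumes c: "admissible_chart A c"
  shows "svf (fst c) (\<lambda>q. coord_vec A c q e)"
  unfolding smooth_vector_field_def
proof (intro conjI ballI allI impI)
  note cd = is_chartD[OF admissibleD(1)[OF c(1)]]
  show "coord_vec A c q e \<in> tangent_space A q" if "q \<in> fst c" for q
    using tangent_space_eq[OF c that] by blast
  fix V f assume "open V \<and> V \<subseteq> fst c \<and> sf V f"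
  then have V: "open V" "V \<subseteq> fst c" "sf V f" by auto
  have "smooth_on (snd c ` V) (f \<circ> chart_inv c)"
    using smooth_function_chart[OF V(3,1) c] V(2) by (simp add: Int_absorb1)
  then have *: "smooth_on (snd c ` V) (\<lambda>x. frechet_derivative (f \<circ> chart_inv c) (at x) e)"
    by (rule smooth_on_frechet_derivative)
  show "sf V (\<lambda>q. coord_vec A c q e f)"
  proof (rule smooth_function_from_chart[OF c V(1,2)], rule smooth_on_cong[OF cd(7)[OF V(1,2)] _ *])
    fix x assume "x \<in> snd c ` V"
    then obtain q where q: "q \<in> V" "q \<in> fst c" "x = snd c q" using V by auto
    then show "frechet_derivative (f \<circ> chart_inv c) (at x) e = ((\<lambda>q. coord_vec A c q e f) \<circ> chart_inv c) x"
      using smooth_nearI[OF V(3,1) q(1)] by (simp add: coord_vec_def cd(4))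
  qed
qed

text \<open>Since W lies in one chart domain, every field is a combination of the coordinate fields
  with coefficients smooth on all of W, and the value of \<Phi> depends only on these coefficients
  at p. The congruence hypothesis is there because fields are total functions with arbitrary values
  off W. The target is a general vector space so that the lemma serves both the curvature and the
  scalar Hessian.\<close>

lemma tensorial_eq:
  fixes \<Phi> :: "('a \<Rightarrow> 'a tvec) \<Rightarrow> 'v::real_vector"
  assumes c: "admissible_chart A c" and W: "open W" "p \<in> W" "W \<subseteq> fst c"
    and add: "\<And>X Y. svf W X \<Longrightarrow> svf W Y \<Longrightarrow> \<Phi> (\<lambda>q. X q + Y q) = \<Phi> X + \<Phi> Y"
    and scale: "\<And>f X. sf W f \<Longrightarrow> svf W X \<Longrightarrow> \<Phi> (\<lambda>q. f q *\<^sub>R X q) = f p *\<^sub>R \<Phi> X"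
    and cong: "\<And>X Y. svf W X \<Longrightarrow> (\<And>q. q \<in> W \<Longrightarrow> Y q = X q) \<Longrightarrow> \<Phi> Y = \<Phi> X"
    and X: "svf W X" and Y: "svf W Y" and XY: "X p = Y p"
  shows "\<Phi> X = \<Phi> Y"
proof -
  let ?E = "\<lambda>b q. coord_vec A c q b"
  have E: "svf W (?E b)" for b by (rule svf_subset[OF svf_coord_vec[OF c] W(3)])
  have expand: "\<Phi> Z = (\<Sum>b\<in>Basis. Z p (coordf c b) *\<^sub>R \<Phi> (?E b))" if Z: "svf W Z" for Z
  proof -
    let ?f = "\<lambda>b q. Z q (coordf c b)"
    have f: "sf W (?f b)" for b
      by (rule svf_apply[OF Z W(1) order_refl smooth_function_subset[OF smooth_function_coordf[OF c] W(3)]])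
    have "svf W (\<lambda>q. \<Sum>b\<in>B. ?f b q *\<^sub>R ?E b q) \<and>
      \<Phi> (\<lambda>q. \<Sum>b\<in>B. ?f b q *\<^sub>R ?E b q) = (\<Sum>b\<in>B. ?f b p *\<^sub>R \<Phi> (?E b))" if "finite B" for B
      using that
    proof (induction B)
      \<comment> \<open>The zero field is written as the constant function 0 times \<open>Z\<close>,
        so that \<open>scale\<close> makes its image vanish.\<close>
      case empty
      show ?case
        using svf_scale[OF smooth_function_const[OF W(1), of 0] Z]
          scale[OF smooth_function_const[OF W(1), of 0] Z] by (simp add: zero_fun_def)
    next
      case (insert b B)
      let ?S = "\<lambda>q. \<Sum>b\<in>B. ?f b q *\<^sub>R ?E b q"
      have S: "svf W ?S" "\<Phi> ?S = (\<Sum>b\<in>B. ?f b p *\<^sub>R \<Phi> (?E b))" using insert.IH by auto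
      have "svf W (\<lambda>q. ?f b q *\<^sub>R ?E b q + ?S q)" by (rule svf_add[OF svf_scale[OF f E] S(1)])
      moreover have "\<Phi> (\<lambda>q. ?f b q *\<^sub>R ?E b q + ?S q) = ?f b p *\<^sub>R \<Phi> (?E b) + (\<Sum>b\<in>B. ?f b p *\<^sub>R \<Phi> (?E b))"
        unfolding add[OF svf_scale[OF f E] S(1)] scale[OF f E] S(2) ..
      ultimately show ?case unfolding sum.insert[OF insert.hyps] by blast
    qed
    note * = this[OF finite_Basis]
    have "\<Phi> Z = \<Phi> (\<lambda>q. \<Sum>b\<in>Basis. ?f b q *\<^sub>R ?E b q)"
      by (rule cong[OF conjunct1[OF *]], rule tangent_space_expand[OF c _ svf_tangent[OF Z]])
        (use W(3) in auto)
    then show ?thesis using conjunct2[OF *] by (rule trans)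
  qed
  show ?thesis using expand[OF X] expand[OF Y] XY by simp
qed

end

section \<open>The metric and the Levi-Civita connection\<close>

locale levi_civita = smooth_mfd A
  for A :: "('a::{t2_space, second_countable_topology}, 'e::euclidean_space) chart set" +
  fixes g :: "'a metric" and D :: "'a connection_op"
  assumes riemannian_metric: "riemannian_metric A g"
    and levi_civita_connection: "levi_civita_connection A g D"
begin

abbreviation "T \<equiv> tangent_space A"

lemmas metric_axioms = riemannian_metric[unfolded riemannian_metric_def]

lemmas metric_add = metric_axioms[THEN conjunct1, rule_format, THEN conjunct1]
  and metric_sym = metric_axioms[THEN conjunct2, THEN conjunct1, rule_format]
  and metric_pos = metric_axioms[THEN conjunct2, THEN conjunct2, THEN conjunct1, rule_format]
  and metric_smooth = metric_axioms[THEN conjunct2, THEN conjunct2, THEN conjunct2, rule_format, OF conjI, OF _ conjI]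

lemma metric_scale: "x \<in> T p \<Longrightarrow> z \<in> T p \<Longrightarrow> g p (k *\<^sub>R x) z = k * g p x z"
  by (rule metric_axioms[THEN conjunct1, rule_format, THEN conjunct2])

lemma affine: "affine_connection A D"
  using levi_civita_connection unfolding levi_civita_connection_def by (rule conjunct1)

context
  fixes W :: "'a set"
  assumes W: "open W"
begin

lemmas affine_at = affine[unfolded affine_connection_def, rule_format, OF conjI, OF W]

lemmas D_tangent = affine_at[THEN conjunct1, rule_format]
  and D_smooth = affine_at[THEN conjunct2, THEN conjunct1, rule_format]
  and D_add_vec = affine_at[THEN conjunct2, THEN conjunct2, THEN conjunct1, rule_format, THEN conjunct1]
  and D_add = affine_at[THEN conjunct2, THEN conjunct2, THEN conjunct2, THEN conjunct1, rule_format]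
  and D_scale = affine_at[THEN conjunct2, THEN conjunct2, THEN conjunct2, THEN conjunct2, THEN conjunct1, rule_format]
  and D_cong = affine_at[THEN conjunct2, THEN conjunct2, THEN conjunct2, THEN conjunct2, THEN conjunct2, rule_format]

lemma D_scale_vec: "svf W Y \<Longrightarrow> p \<in> W \<Longrightarrow> v \<in> T p \<Longrightarrow> D p (k *\<^sub>R v) Y = k *\<^sub>R D p v Y"
  by (rule affine_at[THEN conjunct2, THEN conjunct2, THEN conjunct1, rule_format, THEN conjunct2])

lemma torsion_free: "p \<in> W \<Longrightarrow> svf W X \<Longrightarrow> svf W Y \<Longrightarrow> lie_bracket A X Y p = D p (X p) Y - D p (Y p) X"
  using levi_civita_connection[unfolded levi_civita_connection_def, THEN conjunct2, THEN conjunct1,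
      rule_format, of W p X Y] W by simp

lemma metric_compat: "p \<in> W \<Longrightarrow> svf W Y \<Longrightarrow> svf W Z \<Longrightarrow> v \<in> T p \<Longrightarrow>
    v (\<lambda>q. g q (Y q) (Z q)) = g p (D p v Y) (Z p) + g p (Y p) (D p v Z)"
  using levi_civita_connection[unfolded levi_civita_connection_def, THEN conjunct2, THEN conjunct2,
      rule_format, of W p Y Z v] W by simp

end

end

section \<open>Tensoriality of the curvature\<close>

context levi_civita
begin

section \<open>Bilinearity of the metric on tangent spaces\<close>

lemma tangent_closed:
  "x \<in> T p \<Longrightarrow> y \<in> T p \<Longrightarrow> x + y \<in> T p" "x \<in> T p \<Longrightarrow> y \<in> T p \<Longrightarrow> x - y \<in> T p"
  "x \<in> T p \<Longrightarrow> k *\<^sub>R x \<in> T p" "x \<in> T p \<Longrightarrow> - x \<in> T p" "0 \<in> T p"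
  by (rule subspace_tangent_space[THEN subspace_add] subspace_tangent_space[THEN subspace_diff]
      subspace_tangent_space[THEN subspace_scale] subspace_tangent_space[THEN subspace_neg]
      subspace_tangent_space[THEN subspace_0], assumption?, assumption?)+

lemma metric_right:
  shows "x \<in> T p \<Longrightarrow> y \<in> T p \<Longrightarrow> z \<in> T p \<Longrightarrow> g p z (x + y) = g p z x + g p z y"
    and "x \<in> T p \<Longrightarrow> z \<in> T p \<Longrightarrow> g p z (k *\<^sub>R x) = k * g p z x"
  using metric_add[of x p y z] metric_scale[of x p z k] metric_sym[of z p "x + y"]
    metric_sym[of z p "k *\<^sub>R x"] metric_sym[of z p x] metric_sym[of z p y] tangent_closed(1,3)
  by simp_all

lemma metric_minus:
  assumes "x \<in> T p" "z \<in> T p"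
  shows "g p (- x) z = - g p x z" "g p z (- x) = - g p z x"
  using metric_scale[OF assms, of "-1"] metric_right(2)[OF assms, of "-1"] by simp_all

lemma metric_diff:
  assumes "x \<in> T p" "y \<in> T p" "z \<in> T p"
  shows "g p (x - y) z = g p x z - g p y z" "g p z (x - y) = g p z x - g p z y"
  using metric_add[OF assms(1) tangent_closed(4)[OF assms(2)] assms(3)]
    metric_right(1)[OF assms(1) tangent_closed(4)[OF assms(2)] assms(3)]
    metric_minus[OF assms(2,3)] by simp_all

lemma metric_zero: "z \<in> T p \<Longrightarrow> g p 0 z = 0" "z \<in> T p \<Longrightarrow> g p z 0 = 0"
  using metric_diff[of z p z z] by simp_all

section \<open>Function-linearity of the curvature expression in its fields\<close>

context
  fixes W :: "'a set" and p :: 'a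
  assumes W: "open W" "p \<in> W"
begin

lemma D_minus_vec: "svf W Y \<Longrightarrow> v \<in> T p \<Longrightarrow> D p (- v) Y = - D p v Y"
  using D_scale_vec[OF W(1) _ W(2), where k = "-1"] by simp

lemma lie_bracket_tangent: "svf W X \<Longrightarrow> svf W Y \<Longrightarrow> lie_bracket A X Y p \<in> T p"
  unfolding torsion_free[OF W]
  by (intro tangent_closed(2) D_tangent[OF W(1) _ W(2)] svf_tangent[OF _ W(2)])

lemma curvature_field_tangent:
  assumes "svf W X" "svf W Y" "svf W Z"
  shows "curvature_field A D X Y Z p \<in> T p"
  unfolding curvature_field_def
  by (intro tangent_closed(2) D_tangent[OF W(1) _ W(2)] svf_tangent[OF _ W(2)] D_smooth[OF W(1)]
      lie_bracket_tangent assms)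

lemma curvature_field_antisym:
  assumes "svf W X" "svf W Y" "svf W Z"
  shows "curvature_field A D X Y Z p = - curvature_field A D Y X Z p"
proof -
  have "lie_bracket A X Y p = - lie_bracket A Y X p" by (simp add: lie_bracket_def fun_eq_iff)
  then have "D p (lie_bracket A X Y p) Z = - D p (lie_bracket A Y X p) Z"
    using D_minus_vec[OF assms(3) lie_bracket_tangent[OF assms(2,1)]] by simp
  then show ?thesis by (simp add: curvature_field_def)
qed

lemma curvature_field_add_right:
  assumes X: "svf W X" and Y: "svf W Y" and Z: "svf W Z" "svf W Z'"
  shows "curvature_field A D X Y (\<lambda>q. Z q + Z' q) p = curvature_field A D X Y Z p + curvature_field A D X Y Z' p"
proof -
  have *: "D p v (\<lambda>q. D q (Y q) (\<lambda>q. Z q + Z' q)) = D p v (\<lambda>q. D q (Y q) Z) + D p v (\<lambda>q. D q (Y q) Z')"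
    if v: "v \<in> T p" and Y: "svf W Y" for v Y
  proof -
    note s = D_smooth[OF W(1) Z(1) Y] D_smooth[OF W(1) Z(2) Y]
    have "D p v (\<lambda>q. D q (Y q) (\<lambda>q. Z q + Z' q)) = D p v (\<lambda>q. D q (Y q) Z + D q (Y q) Z')"
      by (rule D_cong[OF W(1) svf_add[OF s] _ W(2) v]) (rule D_add[OF W(1) Z _ svf_tangent[OF Y]])
    then show ?thesis using D_add[OF W(1) s W(2) v] by simp
  qed
  show ?thesis
    unfolding curvature_field_def *[OF svf_tangent[OF X W(2)] Y] *[OF svf_tangent[OF Y W(2)] X]
      D_add[OF W(1) Z W(2) lie_bracket_tangent[OF X Y]] by simp
qed

lemma smooth_near_base: "sf W f \<Longrightarrow> smooth_near A p f"
  using W by (auto intro: smooth_nearI)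

text \<open>The second-order terms left over by the Leibniz rule combine to \<open>[X,Y]f\<close>.\<close>

lemma curvature_field_scale_right:
  assumes X: "svf W X" and Y: "svf W Y" and Z: "svf W Z" and f: "sf W f"
  shows "curvature_field A D X Y (\<lambda>q. f q *\<^sub>R Z q) p = f p *\<^sub>R curvature_field A D X Y Z p"
proof -
  have *: "D p v (\<lambda>q. D q (Y q) (\<lambda>q. f q *\<^sub>R Z q)) =
      v (\<lambda>q. Y q f) *\<^sub>R Z p + Y p f *\<^sub>R D p v Z + (v f *\<^sub>R D p (Y p) Z + f p *\<^sub>R D p v (\<lambda>q. D q (Y q) Z))"
    if v: "v \<in> T p" and Y: "svf W Y" for v Y
  proof -
    have Yf: "sf W (\<lambda>q. Y q f)" by (rule svf_apply[OF Y W(1) order_refl f])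
    note s = D_smooth[OF W(1) Z Y]
    have "D p v (\<lambda>q. D q (Y q) (\<lambda>q. f q *\<^sub>R Z q)) = D p v (\<lambda>q. Y q f *\<^sub>R Z q + f q *\<^sub>R D q (Y q) Z)"
      by (rule D_cong[OF W(1) svf_add[OF svf_scale[OF Yf Z] svf_scale[OF f s]] _ W(2) v])
        (rule D_scale[OF W(1) Z f _ svf_tangent[OF Y]])
    also have "\<dots> = D p v (\<lambda>q. Y q f *\<^sub>R Z q) + D p v (\<lambda>q. f q *\<^sub>R D q (Y q) Z)"
      by (rule D_add[OF W(1) svf_scale[OF Yf Z] svf_scale[OF f s] W(2) v])
    finally show ?thesis
      by (simp only: D_scale[OF W(1) Z Yf W(2) v] D_scale[OF W(1) s f W(2) v])
  qed
  have br: "lie_bracket A X Y p f = X p (\<lambda>q. Y q f) - Y p (\<lambda>q. X q f)"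
    using smooth_near_base[OF f] by (simp add: lie_bracket_def)
  show ?thesis
    unfolding curvature_field_def br *[OF svf_tangent[OF X W(2)] Y] *[OF svf_tangent[OF Y W(2)] X]
      D_scale[OF W(1) Z f W(2) lie_bracket_tangent[OF X Y]]
    by (simp add: algebra_simps)
qed

lemma curvature_field_cong_right:
  assumes X: "svf W X" and Y: "svf W Y" and Z: "svf W Z" and eq: "\<And>q. q \<in> W \<Longrightarrow> Z' q = Z q"
  shows "curvature_field A D X Y Z' p = curvature_field A D X Y Z p"
proof -
  have *: "D p v (\<lambda>q. D q (Y q) Z') = D p v (\<lambda>q. D q (Y q) Z)" if v: "v \<in> T p" and Y: "svf W Y" for v Y
    by (rule D_cong[OF W(1) D_smooth[OF W(1) Z Y] _ W(2) v]) (rule D_cong[OF W(1) Z eq _ svf_tangent[OF Y]])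
  show ?thesis
    unfolding curvature_field_def *[OF svf_tangent[OF X W(2)] Y] *[OF svf_tangent[OF Y W(2)] X]
      using D_cong[OF W(1) Z eq W(2) lie_bracket_tangent[OF X Y]] by simp
qed

text \<open>Torsion-freeness expresses the bracket through \<open>D\<close>, so the additivity of
  the bracket is inherited from the connection.\<close>

lemma curvature_field_add_left:
  assumes X: "svf W X" "svf W X'" and Y: "svf W Y" and Z: "svf W Z"
  shows "curvature_field A D (\<lambda>q. X q + X' q) Y Z p = curvature_field A D X Y Z p + curvature_field A D X' Y Z p"
proof -
  note t = svf_tangent[OF X(1) W(2)] svf_tangent[OF X(2) W(2)] svf_tangent[OF Y W(2)]
  note s = D_smooth[OF W(1) Z X(1)] D_smooth[OF W(1) Z X(2)]
  have "lie_bracket A (\<lambda>q. X q + X' q) Y p = lie_bracket A X Y p + lie_bracket A X' Y p"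
    unfolding torsion_free[OF W svf_add[OF X] Y] torsion_free[OF W X(1) Y] torsion_free[OF W X(2) Y]
      D_add[OF W(1) X W(2) t(3)] D_add_vec[OF W(1) Y W(2) t(1,2)] by simp
  then have 1: "D p (lie_bracket A (\<lambda>q. X q + X' q) Y p) Z = D p (lie_bracket A X Y p) Z + D p (lie_bracket A X' Y p) Z"
    using D_add_vec[OF W(1) Z W(2) lie_bracket_tangent[OF X(1) Y] lie_bracket_tangent[OF X(2) Y]] by simp
  have "D p (Y p) (\<lambda>q. D q (X q + X' q) Z) = D p (Y p) (\<lambda>q. D q (X q) Z + D q (X' q) Z)"
    by (rule D_cong[OF W(1) svf_add[OF s] _ W(2) t(3)])
      (rule D_add_vec[OF W(1) Z _ svf_tangent[OF X(1)] svf_tangent[OF X(2)]])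
  then have 2: "D p (Y p) (\<lambda>q. D q (X q + X' q) Z) = D p (Y p) (\<lambda>q. D q (X q) Z) + D p (Y p) (\<lambda>q. D q (X' q) Z)"
    using D_add[OF W(1) s W(2) t(3)] by simp
  show ?thesis
    unfolding curvature_field_def 1 2 D_add_vec[OF W(1) D_smooth[OF W(1) Z Y] W(2) t(1,2)] by simp
qed

text \<open>From [fX,Y] = f[X,Y] - (Yf)X the bracket term contributes an extra -(Yf) times the
  derivative of Z along X; it cancels against the term that the Leibniz rule produces when f times
  that derivative is differentiated along Y.\<close>

lemma curvature_field_scale_left:
  assumes X: "svf W X" and Y: "svf W Y" and Z: "svf W Z" and f: "sf W f"
  shows "curvature_field A D (\<lambda>q. f q *\<^sub>R X q) Y Z p = f p *\<^sub>R curvature_field A D X Y Z p"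
proof -
  note t = svf_tangent[OF X W(2)] svf_tangent[OF Y W(2)]
  note s = D_smooth[OF W(1) Z X]
  have br: "lie_bracket A (\<lambda>q. f q *\<^sub>R X q) Y p = f p *\<^sub>R lie_bracket A X Y p + (- Y p f) *\<^sub>R X p"
    unfolding torsion_free[OF W svf_scale[OF f X] Y] torsion_free[OF W X Y]
      D_scale[OF W(1) X f W(2) t(2)] D_scale_vec[OF W(1) Y W(2) t(1)] by (simp add: algebra_simps)
  have 1: "D p (lie_bracket A (\<lambda>q. f q *\<^sub>R X q) Y p) Z = f p *\<^sub>R D p (lie_bracket A X Y p) Z + (- Y p f) *\<^sub>R D p (X p) Z"
    unfolding br D_add_vec[OF W(1) Z W(2) tangent_closed(3)[OF lie_bracket_tangent[OF X Y]] tangent_closed(3)[OF t(1)]]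
      D_scale_vec[OF W(1) Z W(2) lie_bracket_tangent[OF X Y]] D_scale_vec[OF W(1) Z W(2) t(1)] ..
  have "D p (Y p) (\<lambda>q. D q (f q *\<^sub>R X q) Z) = D p (Y p) (\<lambda>q. f q *\<^sub>R D q (X q) Z)"
    by (rule D_cong[OF W(1) svf_scale[OF f s] _ W(2) t(2)])
      (rule D_scale_vec[OF W(1) Z _ svf_tangent[OF X]])
  then have 2: "D p (Y p) (\<lambda>q. D q (f q *\<^sub>R X q) Z) = Y p f *\<^sub>R D p (X p) Z + f p *\<^sub>R D p (Y p) (\<lambda>q. D q (X q) Z)"
    using D_scale[OF W(1) s f W(2) t(2)] by simp
  show ?thesis
    unfolding curvature_field_def 1 2 D_scale_vec[OF W(1) D_smooth[OF W(1) Z Y] W(2) t(1)]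
    by (simp add: algebra_simps)
qed

lemma curvature_field_cong_left:
  assumes X: "svf W X" and Y: "svf W Y" and Z: "svf W Z" and eq: "\<And>q. q \<in> W \<Longrightarrow> X' q = X q"
  shows "curvature_field A D X' Y Z p = curvature_field A D X Y Z p"
proof -
  note t = svf_tangent[OF X W(2)] svf_tangent[OF Y W(2)]
  have X': "svf W X'" by (rule svf_cong[OF X]) (simp add: eq)
  have 1: "lie_bracket A X' Y p = lie_bracket A X Y p"
    using D_cong[OF W(1) X eq W(2) t(2)] eq[OF W(2)] by (simp only: torsion_free[OF W X' Y] torsion_free[OF W X Y])
  have 2: "D p (Y p) (\<lambda>q. D q (X' q) Z) = D p (Y p) (\<lambda>q. D q (X q) Z)"
    by (rule D_cong[OF W(1) D_smooth[OF W(1) Z X] _ W(2) t(2)]) (simp add: eq)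
  show ?thesis
    unfolding curvature_field_def 1 2 eq[OF W(2)] ..
qed

end

text \<open>The first and third slots are covered by \<open>tensorial_eq\<close>; the second is
  moved to the first place by antisymmetry and back.\<close>

lemma curvature_field_tensorial:
  assumes W: "open W" "p \<in> W" and c: "admissible_chart A c" "W \<subseteq> fst c"
    and s: "svf W X" "svf W Y" "svf W Z" "svf W X'" "svf W Y'" "svf W Z'"
    and eq: "X p = X' p" "Y p = Y' p" "Z p = Z' p"
  shows "curvature_field A D X Y Z p = curvature_field A D X' Y' Z' p"
proof -
  have left: "curvature_field A D X Y Z p = curvature_field A D X' Y Z p"
    if "svf W X" "svf W X'" "svf W Y" "svf W Z" "X p = X' p" for X X' Y Z
    by (rule tensorial_eq[OF c(1) W c(2), where \<Phi> = "\<lambda>X. curvature_field A D X Y Z p"])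
      (assumption | rule that | rule curvature_field_add_left[OF W] | rule curvature_field_scale_left[OF W]
        | rule curvature_field_cong_left[OF W] | blast)+
  have "curvature_field A D X Y Z p = curvature_field A D X Y Z' p"
    by (rule tensorial_eq[OF c(1) W c(2), where \<Phi> = "\<lambda>Z. curvature_field A D X Y Z p"])
      (assumption | rule s eq | rule curvature_field_add_right[OF W] | rule curvature_field_scale_right[OF W]
        | rule curvature_field_cong_right[OF W] | blast)+
  also have "\<dots> = curvature_field A D X' Y Z' p" by (rule left) (rule s eq)+
  also have "\<dots> = - curvature_field A D Y X' Z' p" by (rule curvature_field_antisym[OF W]) (rule s)+
  also have "\<dots> = - curvature_field A D Y' X' Z' p" using left[OF s(2,5,4,6) eq(2)] by simp
  also have "\<dots> = curvature_field A D X' Y' Z' p"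
    using curvature_field_antisym[OF W s(4,5,6)] by simp
  finally show ?thesis .
qed

text \<open>The description in \<open>curvature_operator\<close> ranges over extensions on arbitrary
  neighbourhoods. Two of these, intersected with a chart domain, give a common set on which
  tensoriality applies; the given fields themselves force uniqueness.\<close>

lemma curvature_operator_eq:
  assumes W: "open W" "p \<in> W" and s: "svf W X" "svf W Y" "svf W Z"
  shows "curvature_operator A D p (X p) (Y p) (Z p) = curvature_field A D X Y Z p"
  unfolding curvature_operator_def
proof (rule the_equality)
  obtain c where c: "c \<in> A" "p \<in> fst c" using atlas_cover .
  show "\<forall>W' X' Y' Z'. open W' \<and> p \<in> W' \<and> svf W' X' \<and> svf W' Y' \<and> svf W' Z' \<and>
      X' p = X p \<and> Y' p = Y p \<and> Z' p = Z p \<longrightarrow> curvature_field A D X Y Z p = curvature_field A D X' Y' Z' p"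
  proof (intro allI impI, elim conjE)
    fix W' X' Y' Z'
    assume *: "open W'" "p \<in> W'" "svf W' X'" "svf W' Y'" "svf W' Z'"
      "X' p = X p" "Y' p = Y p" "Z' p = Z p"
    let ?V = "W \<inter> W' \<inter> fst c"
    have "open (fst c)" by (rule is_chartD(1)[OF atlas_chart[OF c(1)]])
    then show "curvature_field A D X Y Z p = curvature_field A D X' Y' Z' p"
      by (intro curvature_field_tensorial[of ?V])
        (use * W s c in \<open>auto intro: svf_subset atlas_admissible\<close>)
  qed
qed (use W s in blast)

end

section \<open>Symmetries of the curvature\<close>

context levi_civita
begin

text \<open>The field on the chart domain whose components are constantly those of x. They are
  recovered by applying x to the coordinate functions, so the base point of x does not
  appear.\<close>

definition ext :: "('a, 'e) chart \<Rightarrow> 'a tvec \<Rightarrow> 'a \<Rightarrow> 'a tvec"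
  where "ext c x q = coord_vec A c q (\<Sum>b\<in>Basis. x (coordf c b) *\<^sub>R b)"

lemma svf_ext: "admissible_chart A c \<Longrightarrow> svf (fst c) (ext c x)"
  unfolding ext_def by (rule svf_coord_vec)

lemma
  assumes c: "admissible_chart A c" "p \<in> fst c" and x: "x \<in> T p"
  shows ext_base: "ext c x p = x"
    and ext_coordf: "q \<in> fst c \<Longrightarrow> ext c x q (coordf c u) = x (coordf c u)"
proof -
  obtain e where e: "x = coord_vec A c p e" "\<forall>u. x (coordf c u) = e \<bullet> u"
    using tangent_space_coord[OF c x] by blast
  then have *: "(\<Sum>b\<in>Basis. x (coordf c b) *\<^sub>R b) = e" by (simp add: euclidean_representation)
  show "ext c x p = x" unfolding ext_def * using e(1) by simp
  show "ext c x q (coordf c u) = x (coordf c u)" if "q \<in> fst c"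
    unfolding ext_def * coord_vec_coordf[OF c(1) that] using e(2) by simp
qed

lemma ext_add:
  assumes "admissible_chart A c" "q \<in> fst c"
  shows "ext c (x + y) q = ext c x q + ext c y q"
  by (simp add: ext_def scaleR_add_left sum.distrib linear_add[OF linear_coord_vec[OF assms]])

lemma ext_scale:
  assumes "admissible_chart A c" "q \<in> fst c"
  shows "ext c (k *\<^sub>R x) q = k *\<^sub>R ext c x q"
  unfolding linear_scale[OF linear_coord_vec[OF assms], symmetric] ext_def
  by (simp add: scaleR_fun_def scaleR_sum_right)

lemma tangent_cong:
  assumes "v \<in> T p" "smooth_near A p f" "smooth_near A p h" "open W" "p \<in> W"
    and "\<And>r. r \<in> W \<Longrightarrow> f r = h r"
  shows "v f = v h"
  by (rule tangent_within_cong[OF assms(1-5)]) (rule assms(6))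

text \<open>By torsion-freeness the bracket of coordinate fields is a tangent vector that
  kills all coordinate functions, so it vanishes without any appeal to the symmetry of second
  derivatives.\<close>

lemma lie_bracket_ext:
  assumes c: "admissible_chart A c" "p \<in> fst c" and x: "x \<in> T p" "y \<in> T p" and q: "q \<in> fst c"
  shows "lie_bracket A (ext c x) (ext c y) q = 0"
proof (rule tangent_space_eqI[OF c(1) q])
  have W: "open (fst c)" by (rule is_chartD(1)[OF admissibleD(1)[OF c(1)]])
  note s = svf_ext[OF c(1)]
  show "lie_bracket A (ext c x) (ext c y) q \<in> T q" by (rule lie_bracket_tangent[OF W q s s])
  show "0 \<in> T q" by (rule tangent_closed)
  fix u
  note sc = smooth_near_coordf[OF c(1) q, of u]
  have *: "ext c x q (\<lambda>r. ext c y r (coordf c u)) = 0" if "x \<in> T p" "y \<in> T p" for x y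
  proof -
    have "ext c x q (\<lambda>r. ext c y r (coordf c u)) = ext c x q (\<lambda>r. y (coordf c u))"
      by (rule tangent_cong[OF svf_tangent[OF s q] smooth_near_svf_apply[OF s W q sc] smooth_near_const W q])
        (rule ext_coordf[OF c that(2)])
    then show ?thesis using tangent_const[OF svf_tangent[OF s q]] by simp
  qed
  show "lie_bracket A (ext c x) (ext c y) q (coordf c u) = 0 (coordf c u)"
    using sc *[OF x] *[OF x(2,1)] by (simp add: lie_bracket_def)
qed

lemma D_ext_commute:
  assumes c: "admissible_chart A c" "p \<in> fst c" and x: "x \<in> T p" "y \<in> T p"
  shows "D p x (ext c y) = D p y (ext c x)"
  using torsion_free[OF is_chartD(1)[OF admissibleD(1)[OF c(1)]] c(2) svf_ext[OF c(1)] svf_ext[OF c(1)], of x y]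
    lie_bracket_ext[OF c x c(2)] ext_base[OF c x(1)] ext_base[OF c x(2)] by simp

abbreviation "R \<equiv> curvature_operator A D"

lemma curvature_operator_ext:
  assumes c: "admissible_chart A c" "p \<in> fst c" and x: "x \<in> T p" "y \<in> T p" "z \<in> T p"
  shows "R p x y z = curvature_field A D (ext c x) (ext c y) (ext c z) p"
  using curvature_operator_eq[OF is_chartD(1)[OF admissibleD(1)[OF c(1)]] c(2) svf_ext[OF c(1)] svf_ext[OF c(1)]
      svf_ext[OF c(1)], of x y z] ext_base[OF c x(1)] ext_base[OF c x(2)] ext_base[OF c x(3)] by simp

lemma D_zero:
  assumes "open W" "p \<in> W" "svf W Y"
  shows "D p 0 Y = 0"
  using D_scale_vec[OF assms(1,3,2) tangent_closed(5), where k = 0] by simp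

lemma curvature_operator_ext_D:
  assumes c: "admissible_chart A c" "p \<in> fst c" and x: "x \<in> T p" "y \<in> T p" "z \<in> T p"
  shows "R p x y z = D p y (\<lambda>q. D q (ext c x q) (ext c z)) - D p x (\<lambda>q. D q (ext c y q) (ext c z))"
  unfolding curvature_operator_ext[OF c x] curvature_field_def lie_bracket_ext[OF c x(1,2) c(2)]
    ext_base[OF c x(1)] ext_base[OF c x(2)]
    D_zero[OF is_chartD(1)[OF admissibleD(1)[OF c(1)]] c(2) svf_ext[OF c(1)]] by simp

section \<open>Algebraic symmetries of the curvature at a point\<close>

context
  fixes p :: 'a and x y z :: "'a tvec"
  assumes xyz: "x \<in> T p" "y \<in> T p" "z \<in> T p"
begin

lemma curvature_operator_tangent: "R p x y z \<in> T p"
proof -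
  obtain c where c: "c \<in> A" "p \<in> fst c" using atlas_cover .
  note ca = atlas_admissible[OF c(1)] c(2)
  show ?thesis
    unfolding curvature_operator_ext[OF ca xyz]
    by (rule curvature_field_tangent[OF is_chartD(1)[OF atlas_chart[OF c(1)]] c(2)]; rule svf_ext[OF ca(1)])
qed

lemma curvature_operator_antisym: "R p x y z = - R p y x z"
proof -
  obtain c where c: "c \<in> A" "p \<in> fst c" using atlas_cover .
  note ca = atlas_admissible[OF c(1)] c(2)
  show ?thesis
    unfolding curvature_operator_ext[OF ca xyz] curvature_operator_ext[OF ca xyz(2,1,3)]
    by (rule curvature_field_antisym[OF is_chartD(1)[OF atlas_chart[OF c(1)]] c(2)]; rule svf_ext[OF ca(1)])
qed

lemma curvature_operator_add_left:
  assumes x': "x' \<in> T p"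
  shows "R p (x + x') y z = R p x y z + R p x' y z"
proof -
  obtain c where c: "c \<in> A" "p \<in> fst c" using atlas_cover .
  note ca = atlas_admissible[OF c(1)] c(2)
  note W = is_chartD(1)[OF atlas_chart[OF c(1)]] c(2) and s = svf_ext[OF ca(1)]
  \<comment> \<open>The extension of a sum and the sum of the extensions are known to agree on the
    chart domain only, hence the congruence rule instead of rewriting.\<close>
  have "curvature_field A D (ext c (x + x')) (ext c y) (ext c z) p =
    curvature_field A D (\<lambda>q. ext c x q + ext c x' q) (ext c y) (ext c z) p"
    by (rule curvature_field_cong_left[OF W svf_add[OF s s] s s]) (rule ext_add[OF ca(1)])
  then show ?thesis
    unfolding curvature_operator_ext[OF ca tangent_closed(1)[OF xyz(1) x'] xyz(2,3)]
      curvature_operator_ext[OF ca xyz] curvature_operator_ext[OF ca x' xyz(2,3)]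
    unfolding curvature_field_add_left[OF W s s s s] .
qed

lemma curvature_operator_scale_left: "R p (k *\<^sub>R x) y z = k *\<^sub>R R p x y z"
proof -
  obtain c where c: "c \<in> A" "p \<in> fst c" using atlas_cover .
  note ca = atlas_admissible[OF c(1)] c(2)
  note W = is_chartD(1)[OF atlas_chart[OF c(1)]] c(2) and s = svf_ext[OF ca(1)]
  note k = smooth_function_const[OF W(1), of k]
  have "curvature_field A D (ext c (k *\<^sub>R x)) (ext c y) (ext c z) p =
    curvature_field A D (\<lambda>q. k *\<^sub>R ext c x q) (ext c y) (ext c z) p"
    by (rule curvature_field_cong_left[OF W svf_scale[OF k s] s s]) (rule ext_scale[OF ca(1)])
  then show ?thesis
    unfolding curvature_operator_ext[OF ca tangent_closed(3)[OF xyz(1)] xyz(2,3)]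
      curvature_operator_ext[OF ca xyz]
    unfolding curvature_field_scale_left[OF W s s s k] .
qed

lemma curvature_operator_add_right:
  assumes z': "z' \<in> T p"
  shows "R p x y (z + z') = R p x y z + R p x y z'"
proof -
  obtain c where c: "c \<in> A" "p \<in> fst c" using atlas_cover .
  note ca = atlas_admissible[OF c(1)] c(2)
  note W = is_chartD(1)[OF atlas_chart[OF c(1)]] c(2) and s = svf_ext[OF ca(1)]
  have "curvature_field A D (ext c x) (ext c y) (ext c (z + z')) p =
    curvature_field A D (ext c x) (ext c y) (\<lambda>q. ext c z q + ext c z' q) p"
    by (rule curvature_field_cong_right[OF W s s svf_add[OF s s]]) (rule ext_add[OF ca(1)])
  then show ?thesis
    unfolding curvature_operator_ext[OF ca xyz(1,2) tangent_closed(1)[OF xyz(3) z']]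
      curvature_operator_ext[OF ca xyz] curvature_operator_ext[OF ca xyz(1,2) z']
    unfolding curvature_field_add_right[OF W s s s s] .
qed

lemma curvature_operator_scale_right: "R p x y (k *\<^sub>R z) = k *\<^sub>R R p x y z"
proof -
  obtain c where c: "c \<in> A" "p \<in> fst c" using atlas_cover .
  note ca = atlas_admissible[OF c(1)] c(2)
  note W = is_chartD(1)[OF atlas_chart[OF c(1)]] c(2) and s = svf_ext[OF ca(1)]
  note k = smooth_function_const[OF W(1), of k]
  have "curvature_field A D (ext c x) (ext c y) (ext c (k *\<^sub>R z)) p =
    curvature_field A D (ext c x) (ext c y) (\<lambda>q. k *\<^sub>R ext c z q) p"
    by (rule curvature_field_cong_right[OF W s s svf_scale[OF k s]]) (rule ext_scale[OF ca(1)])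
  then show ?thesis
    unfolding curvature_operator_ext[OF ca xyz(1,2) tangent_closed(3)[OF xyz(3)]]
      curvature_operator_ext[OF ca xyz]
    unfolding curvature_field_scale_right[OF W s s s k] .
qed

text \<open>Differentiating \<open>g(Z,Z)\<close> along the commuting fields \<open>X\<close>, \<open>Y\<close> in both orders.\<close>

lemma metric_curvature_operator_self: "g p (R p x y z) z = 0"
proof -
  obtain c where c: "c \<in> A" "p \<in> fst c" using atlas_cover .
  note ca = atlas_admissible[OF c(1)] c(2)
  note W = is_chartD(1)[OF atlas_chart[OF c(1)]] and s = svf_ext[OF ca(1)]
  let ?Z = "ext c z"
  let ?f = "\<lambda>q. g q (?Z q) (?Z q)"
  have f: "sf (fst c) ?f" by (rule metric_smooth[OF W s s])
  have *: "ext c x p (\<lambda>q. ext c y q ?f) =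
    2 * (g p (D p x (\<lambda>q. D q (ext c y q) ?Z)) z + g p (D p y ?Z) (D p x ?Z))"
    if x: "x \<in> T p" and y: "y \<in> T p" for x y
  proof -
    let ?F = "\<lambda>q. D q (ext c y q) ?Z"
    let ?h = "\<lambda>q. g q (?F q) (?Z q)"
    have F: "svf (fst c) ?F" by (rule D_smooth[OF W s s])
    have h: "smooth_near A p ?h" by (rule smooth_nearI[OF metric_smooth[OF W F s] W c(2)])
    have "ext c y q ?f = 2 * ?h q" if q: "q \<in> fst c" for q
      unfolding metric_compat[OF W q s s svf_tangent[OF s q]]
      using metric_sym[OF svf_tangent[OF s q] svf_tangent[OF F q], of z] by simp
    then have "ext c x p (\<lambda>q. ext c y q ?f) = ext c x p (\<lambda>q. 2 * ?h q)"
      by (rule tangent_cong[OF svf_tangent[OF s c(2)] smooth_near_svf_apply[OF s W c(2) smooth_nearI[OF f W c(2)]]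
          smooth_near_mult[OF smooth_near_const h] W c(2)])
    also have "\<dots> = 2 * ext c x p ?h"
      unfolding tangent_mult[OF svf_tangent[OF s c(2)] smooth_near_const h]
        tangent_const[OF svf_tangent[OF s c(2)]] by simp
    also have "ext c x p ?h = g p (D p x ?F) z + g p (D p y ?Z) (D p x ?Z)"
      using metric_compat[OF W c(2) F s svf_tangent[OF s c(2)], of x z]
      by (simp add: ext_base[OF ca x] ext_base[OF ca y] ext_base[OF ca xyz(3)])
    finally show ?thesis .
  qed
  have "lie_bracket A (ext c x) (ext c y) p ?f = 0"
    using lie_bracket_ext[OF ca xyz(1,2) c(2)] by simp
  then have "ext c x p (\<lambda>q. ext c y q ?f) = ext c y p (\<lambda>q. ext c x q ?f)"
    using smooth_nearI[OF f W c(2)] by (simp add: lie_bracket_def)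
  then have "g p (D p x (\<lambda>q. D q (ext c y q) ?Z)) z + g p (D p y ?Z) (D p x ?Z) =
     g p (D p y (\<lambda>q. D q (ext c x q) ?Z)) z + g p (D p x ?Z) (D p y ?Z)"
    unfolding *[OF xyz(1,2)] *[OF xyz(2,1)] by simp
  moreover have "g p (D p x ?Z) (D p y ?Z) = g p (D p y ?Z) (D p x ?Z)"
    by (rule metric_sym[OF D_tangent[OF W s c(2) xyz(1)] D_tangent[OF W s c(2) xyz(2)]])
  ultimately have "g p (D p x (\<lambda>q. D q (ext c y q) ?Z)) z = g p (D p y (\<lambda>q. D q (ext c x q) ?Z)) z"
    by simp
  moreover have t: "D p v (\<lambda>q. D q (ext c w q) ?Z) \<in> T p" if "v \<in> T p" for v w
    by (rule D_tangent[OF W D_smooth[OF W s s] c(2) that])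
  ultimately show ?thesis
    unfolding curvature_operator_ext_D[OF ca xyz] metric_diff(1)[OF t[OF xyz(2)] t[OF xyz(1)] xyz(3)] by simp
qed

end

text \<open>Polarization: the quadratic form \<open>metric_curvature_operator_self\<close> vanishes
  at \<open>z\<close>, \<open>u\<close> and \<open>z + u\<close>.\<close>

lemma curvature_antisym_right:
  assumes xy: "x \<in> T p" "y \<in> T p" and zu: "z \<in> T p" "u \<in> T p"
  shows "g p (R p x y z) u = - g p (R p x y u) z"
proof -
  note Rz = curvature_operator_tangent[OF xy zu(1)] and Ru = curvature_operator_tangent[OF xy zu(2)]
  have "g p (R p x y (z + u)) (z + u) = 0"
    by (rule metric_curvature_operator_self[OF xy tangent_closed(1)[OF zu]])
  then show ?thesis
    unfolding curvature_operator_add_right[OF xy zu] metric_add[OF Rz Ru tangent_closed(1)[OF zu]]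
      metric_right(1)[OF zu Rz] metric_right(1)[OF zu Ru]
    using metric_curvature_operator_self[OF xy zu(1)] metric_curvature_operator_self[OF xy zu(2)] by simp
qed

end

section \<open>Totally umbilical submanifolds\<close>

context levi_civita
begin

section \<open>Orthogonal projection in a tangent space\<close>

lemma subspace_orthogonal:
  assumes "w \<in> T p"
  shows "subspace {z \<in> T p. g p w z = 0}"
  by (rule subspaceI) (simp_all add: assms tangent_closed metric_zero metric_right)

lemma orthogonal_span:
  assumes "w \<in> T p" "S \<subseteq> T p" "\<And>s. s \<in> S \<Longrightarrow> g p w s = 0" "z \<in> span S"
  shows "g p w z = 0"
proof -
  have "span S \<subseteq> {z \<in> T p. g p w z = 0}"
    by (rule span_minimal[OF _ subspace_orthogonal[OF assms(1)]]) (use assms in auto)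
  then show ?thesis using assms(4) by blast
qed

lemma span_tangent: "S \<subseteq> T p \<Longrightarrow> span S \<subseteq> T p"
  by (rule span_minimal[OF _ subspace_tangent_space])

text \<open>Gram-Schmidt as an induction on the spanning set: the new vector s is first replaced by
  its part \<open>s'\<close> orthogonal to S, and then the component along \<open>s'\<close> is
  subtracted. S may be linearly dependent.\<close>

lemma orthogonal_projection_exists:
  assumes "finite S" "S \<subseteq> T p" "v \<in> T p"
  shows "\<exists>w\<in>T p. v - w \<in> span S \<and> (\<forall>s\<in>S. g p w s = 0)"
  using assms
proof (induction S arbitrary: v)
  case empty
  then show ?case by (intro bexI[of _ v]) auto
next
  case (insert s S)
  then have s: "s \<in> T p" and S: "S \<subseteq> T p" by auto
  obtain w where w: "w \<in> T p" "v - w \<in> span S" "\<And>s. s \<in> S \<Longrightarrow> g p w s = 0"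
    using insert.IH[OF S insert.prems(2)] by blast
  obtain s' where s': "s' \<in> T p" "s - s' \<in> span S" "\<And>r. r \<in> S \<Longrightarrow> g p s' r = 0"
    using insert.IH[OF S s] by blast
  have sub: "span S \<subseteq> span (insert s S)" by (rule span_mono) auto
  have s'_span: "s' \<in> span (insert s S)"
    using span_diff[OF span_base[of s "insert s S"], of "s - s'"] s'(2) sub by auto
  have gs: "g p x s = g p x s'" if x: "x \<in> T p" "\<And>r. r \<in> S \<Longrightarrow> g p x r = 0" for x
  proof -
    have "g p x (s - s') = 0" by (rule orthogonal_span[OF x(1) S x(2) s'(2)])
    then show ?thesis using metric_diff(2)[OF s s'(1) x(1)] by simp
  qed
  \<comment> \<open>If s already lies in the span of S, then \<open>s'\<close> is 0 and division by
    zero gives k = 0, so that w is left unchanged.\<close>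
  define k where "k = g p w s' / g p s' s'"
  let ?w = "w - k *\<^sub>R s'"
  have wT: "?w \<in> T p" by (intro tangent_closed w s')
  have gw: "g p ?w r = g p w r - k * g p s' r" if "r \<in> T p" for r
    using metric_diff(1)[OF w(1) tangent_closed(3)[OF s'(1)] that, of k] metric_scale[OF s'(1) that, of k] by simp
  have 1: "g p ?w r = 0" if "r \<in> S" for r
    using gw[of r] w(3)[OF that] s'(3)[OF that] S that by auto
  have "g p ?w s' = 0"
  proof (cases "s' = 0")
    case True
    then show ?thesis using metric_zero[OF wT] by simp
  next
    case False
    then show ?thesis using gw[OF s'(1)] metric_pos[OF s'(1)] by (simp add: k_def)
  qed
  then have 2: "g p ?w s = 0" using gs[OF wT 1] by simp
  have eq: "v - ?w = (v - w) + k *\<^sub>R s'" by simp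
  have "v - ?w \<in> span (insert s S)"
    unfolding eq by (rule span_add[OF subsetD[OF sub w(2)] span_scale[OF s'_span]])
  then show ?case using wT 1 2 by blast
qed

end

text \<open>A slice chart of a submanifold; \<open>u \<bottom> L\<close> gives the coordinate functions vanishing on \<open>N\<close>, whose
  differentials cut out the tangent spaces of \<open>N\<close>.\<close>

locale slice = levi_civita A g D
  for A :: "('a::{t2_space, second_countable_topology}, 'e::euclidean_space) chart set"
    and g :: "'a metric" and D :: "'a connection_op" +
  fixes c :: "('a, 'e) chart" and L :: "'e set" and N :: "'a set"
  assumes c: "admissible_chart A c"
    and L: "subspace L" "snd c ` (fst c \<inter> N) = snd c ` fst c \<inter> L"
begin

abbreviation "U \<equiv> fst c"
abbreviation "TN \<equiv> tangent_space_within A N"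

lemma open_U: "open U"
  by (rule is_chartD(1)[OF admissibleD(1)[OF c]])

lemma TN_eq: "q \<in> U \<Longrightarrow> q \<in> N \<Longrightarrow> TN q = coord_vec A c q ` L"
  by (rule tangent_space_within_slice[OF c _ _ L])

definition conormal :: "'e \<Rightarrow> bool"
  where "conormal u \<longleftrightarrow> (\<forall>l\<in>L. l \<bullet> u = 0)"

lemma TN_T: "v \<in> TN q \<Longrightarrow> v \<in> T q"
  using tangent_within_subset by blast

lemma TN_D: 
  assumes "q \<in> U" "q \<in> N" "conormal u" "v \<in> TN q"
  shows "v (coordf c u) = 0"
  using assms unfolding TN_eq[OF assms(1,2)] conormal_def by (auto simp: coord_vec_coordf[OF c])

lemma TN_I:
  assumes q: "q \<in> U" "q \<in> N" and v: "v \<in> T q" "\<And>u. conormal u \<Longrightarrow> v (coordf c u) = 0"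
  shows "v \<in> TN q"
proof -
  obtain e where e: "v = coord_vec A c q e" "\<forall>u. v (coordf c u) = e \<bullet> u"
    using tangent_space_coord[OF c q(1) v(1)] by blast
  have "e \<in> L"
    by (rule subspace_eq_annihilator[OF L(1)]) (use v(2) e(2) in \<open>auto simp: conormal_def\<close>)
  then show ?thesis unfolding TN_eq[OF q] e(1) by (rule imageI)
qed

lemma subspace_TN:
  assumes "q \<in> U" "q \<in> N"
  shows "subspace (TN q)"
  unfolding TN_eq[OF assms] by (rule linear_subspace_image[OF linear_coord_vec[OF c assms(1)] L(1)])

context
  fixes q assumes q: "q \<in> U" "q \<in> N"
begin

text \<open>Projection along the image of a basis of \<open>L\<close> gives existence. The
  difference of two candidates is both tangent and orthogonal to N, so positivity of the metric
  makes it 0.\<close>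

lemma normal_part_ex1:
  assumes v: "v \<in> T q"
  shows "\<exists>!w. w \<in> T q \<and> (\<forall>z\<in>TN q. g q w z = 0) \<and> v - w \<in> TN q"
proof -
  obtain B where B: "B \<subseteq> L" "independent B" "L \<subseteq> span B" using maximal_independent_subset by blast
  have "span B = L" using B L(1) by (simp add: span_minimal subset_antisym)
  then have TN: "TN q = span (coord_vec A c q ` B)"
    unfolding TN_eq[OF q] using linear_span_image[OF linear_coord_vec[OF c q(1)], of B] by simp
  have fin: "finite (coord_vec A c q ` B)" using independent_imp_finite[OF B(2)] by simp
  have sub: "coord_vec A c q ` B \<subseteq> T q" using tangent_space_eq[OF c q(1)] by auto
  obtain w where w: "w \<in> T q" "v - w \<in> TN q" "\<And>s. s \<in> coord_vec A c q ` B \<Longrightarrow> g q w s = 0"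
    using orthogonal_projection_exists[OF fin sub v] unfolding TN by blast
  have w': "\<forall>z\<in>TN q. g q w z = 0"
    unfolding TN using orthogonal_span[OF w(1) sub w(3)] by blast
  show ?thesis
  proof (rule ex1I)
    show "w \<in> T q \<and> (\<forall>z\<in>TN q. g q w z = 0) \<and> v - w \<in> TN q" using w w' by blast
    fix y assume y: "y \<in> T q \<and> (\<forall>z\<in>TN q. g q y z = 0) \<and> v - y \<in> TN q"
    have "(v - y) - (v - w) \<in> TN q"
      by (rule subspace_diff[OF subspace_TN[OF q]]) (use w(2) y in auto)
    then have d: "w - y \<in> TN q" by simp
    then have "g q (w - y) (w - y) = 0"
      using metric_diff(1)[OF w(1) _ TN_T[OF d], of y] y w' by simp
    then have "w - y = 0" using metric_pos[OF TN_T[OF d]] by force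
    then show "y = w" by simp
  qed
qed

lemma normal_part:
  assumes "v \<in> T q"
  shows "normal_part A g N q v \<in> T q" "v - normal_part A g N q v \<in> TN q"
  using theI'[OF normal_part_ex1[OF assms]] unfolding normal_part_def by blast+

lemma normal_part_cong:
  assumes v: "v \<in> T q" "v' \<in> T q" and d: "v - v' \<in> TN q"
  shows "normal_part A g N q v = normal_part A g N q v'"
proof -
  have 1: "normal_part A g N q v' \<in> T q" "\<forall>z\<in>TN q. g q (normal_part A g N q v') z = 0"
    "v' - normal_part A g N q v' \<in> TN q"
    using theI'[OF normal_part_ex1[OF v(2)]] unfolding normal_part_def by blast+
  have "v - normal_part A g N q v' \<in> TN q"
    using subspace_add[OF subspace_TN[OF q] d 1(3)] by simp
  then show ?thesis
    unfolding normal_part_def[of A g N q v] using 1 by (intro the1_equality[OF normal_part_ex1[OF v(1)]]) blast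
qed

text \<open>The Hessian of the coordinate function of \<open>u\<close>, hence tensorial in \<open>Y\<close>.\<close>

definition hess :: "'e \<Rightarrow> 'a tvec \<Rightarrow> ('a \<Rightarrow> 'a tvec) \<Rightarrow> real"
  where "hess u x Y = x (\<lambda>r. Y r (coordf c u)) - D q x Y (coordf c u)"

text \<open>Both terms of \<open>hess\<close> obey a Leibniz rule in Y with the same extra summand,
  x f times the value of Y on the coordinate function; in the difference it cancels.\<close>

lemma hess_tensorial:
  assumes W: "open W" "q \<in> W" "W \<subseteq> U" and x: "x \<in> T q"
    and Y: "svf W Y" "svf W Y'" "Y q = Y' q"
  shows "hess u x Y = hess u x Y'"
proof -
  have near: "smooth_near A q (\<lambda>r. X r (coordf c u))" if "svf W X" for X
    by (rule smooth_near_svf_apply[OF that W(1,2) smooth_near_coordf[OF c q(1)]])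
  have add: "hess u x (\<lambda>r. X r + Y r) = hess u x X + hess u x Y" if XY: "svf W X" "svf W Y" for X Y
    using tangent_add[OF x near[OF XY(1)] near[OF XY(2)]] D_add[OF W(1) XY W(2) x]
    by (simp add: hess_def)
  have scale: "hess u x (\<lambda>r. f r *\<^sub>R X r) = f q *\<^sub>R hess u x X" if f: "sf W f" and X: "svf W X" for f X
    using tangent_mult[OF x smooth_nearI[OF f W(1,2)] near[OF X]] D_scale[OF W(1) X f W(2) x]
    by (simp add: hess_def scaleR_fun_def algebra_simps)
  have cong: "hess u x X' = hess u x X" if X: "svf W X" and eq: "\<And>r. r \<in> W \<Longrightarrow> X' r = X r" for X X'
  proof -
    have X': "svf W X'" by (rule svf_cong[OF X]) (simp add: eq)
    have "x (\<lambda>r. X' r (coordf c u)) = x (\<lambda>r. X r (coordf c u))"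
      by (rule tangent_cong[OF x near[OF X'] near[OF X] W(1,2)]) (simp add: eq)
    then show ?thesis using D_cong[OF W(1) X eq W(2) x] by (simp add: hess_def)
  qed
  show ?thesis by (rule tensorial_eq[OF c W, where \<Phi> = "hess u x", OF add scale cong Y])
qed

text \<open>For conormal u a field tangent to N along N kills the coordinate function at points of
  N, so the first term of \<open>hess\<close> vanishes in directions tangent to N. The Hessian then
  shows that the derivatives of two such extensions agree on all conormal coordinates: they differ
  by a vector tangent to N, which the normal part ignores.\<close>

lemma second_fundamental_form_eq:
  assumes W: "open W" "q \<in> W" and Y: "svf W Y" "\<And>r. r \<in> W \<inter> N \<Longrightarrow> Y r \<in> TN r" and x: "x \<in> TN q"
  shows "second_fundamental_form A g D N q x (Y q) = normal_part A g N q (D q x Y)"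
  unfolding second_fundamental_form_def
proof (rule the_equality)
  note xT = TN_T[OF x]
  show "\<forall>W' Y'. open W' \<and> q \<in> W' \<and> svf W' Y' \<and> (\<forall>r\<in>W' \<inter> N. Y' r \<in> TN r) \<and> Y' q = Y q \<longrightarrow>
    normal_part A g N q (D q x Y) = normal_part A g N q (D q x Y')"
  proof (intro allI impI, elim conjE)
    fix W' Y' assume W': "open W'" "q \<in> W'" and Y': "svf W' Y'" "\<forall>r\<in>W' \<inter> N. Y' r \<in> TN r" "Y' q = Y q"
    let ?V = "W \<inter> W' \<inter> U"
    have V: "open ?V" "q \<in> ?V" "?V \<subseteq> U" using W W' q open_U by auto
    have YV: "svf ?V Y" "svf ?V Y'"
      by (rule svf_subset[OF Y(1)], blast) (rule svf_subset[OF Y'(1)], blast)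
    have 0: "x (\<lambda>r. X r (coordf c u)) = 0" if X: "svf ?V X" "\<And>r. r \<in> ?V \<Longrightarrow> r \<in> N \<Longrightarrow> X r \<in> TN r" and u: "conormal u" for X u
    proof -
      have "x (\<lambda>r. X r (coordf c u)) = x (\<lambda>r. 0)"
        by (rule tangent_within_cong[OF x smooth_near_svf_apply[OF X(1) V(1,2) smooth_near_coordf[OF c q(1)]]
            smooth_near_const V(1,2)]) (use TN_D u X(2) in auto)
      then show ?thesis using tangent_const[OF xT] by simp
    qed
    have D: "D q x Y \<in> T q" "D q x Y' \<in> T q"
      by (rule D_tangent[OF V(1) YV(1) V(2) xT], rule D_tangent[OF V(1) YV(2) V(2) xT])
    have "D q x Y - D q x Y' \<in> TN q"
    proof (rule TN_I[OF q tangent_closed(2)[OF D]])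
      fix u assume u: "conormal u"
      show "(D q x Y - D q x Y') (coordf c u) = 0"
        using hess_tensorial[OF V xT YV Y'(3)[symmetric], of u] 0[OF YV(1) _ u] 0[OF YV(2) _ u] Y(2) Y'(2)
        by (simp add: hess_def)
    qed
    then show "normal_part A g N q (D q x Y) = normal_part A g N q (D q x Y')"
      by (rule normal_part_cong[OF D])
  qed
qed (use W Y in blast)

end

text \<open>Tangency to N is the vanishing of the conormal components, and the components of
  \<open>ext c x\<close> are constant. So umbilicity applies to these fields at every point of N in
  the chart, not only at p.\<close>

lemma ext_TN:
  assumes p: "p \<in> U" "p \<in> N" and x: "x \<in> TN p" and r: "r \<in> U" "r \<in> N"
  shows "ext c x r \<in> TN r"
proof (rule TN_I[OF r svf_tangent[OF svf_ext[OF c] r(1)]])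
  fix u assume u: "conormal u"
  show "ext c x r (coordf c u) = 0"
    using ext_coordf[OF c p(1) TN_T[OF x] r(1)] TN_D[OF p u x] by simp
qed

text \<open>A conormal coordinate function is killed by the tangential part, so the umbilicity
  condition on normal parts becomes a scalar identity for the covariant derivative itself.\<close>

lemma umbilical_D:
  assumes umb: "totally_umbilical A g D N"
    and p: "p \<in> U" "p \<in> N" and x: "x \<in> TN p" "y \<in> TN p" and q: "q \<in> U" "q \<in> N" and u: "conormal u"
  shows "D q (ext c x q) (ext c y) (coordf c u) =
    g q (ext c x q) (ext c y q) * mean_curvature A g D N q (coordf c u)"
proof -
  note xq = ext_TN[OF p x(1) q] and yq = ext_TN[OF p x(2) q]
  have Dt: "D q (ext c x q) (ext c y) \<in> T q"
    by (rule D_tangent[OF open_U svf_ext[OF c] q(1) TN_T[OF xq]])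
  have "normal_part A g N q (D q (ext c x q) (ext c y)) = g q (ext c x q) (ext c y q) *\<^sub>R mean_curvature A g D N q"
    using second_fundamental_form_eq[OF q open_U q(1) svf_ext[OF c] _ xq, of y] ext_TN[OF p x(2)]
      umb xq yq q unfolding totally_umbilical_def by auto
  then show ?thesis
    using TN_D[OF q u normal_part(2)[OF q Dt]] by (simp add: scaleR_fun_def)
qed


text \<open>The Codazzi equation. Modulo \<open>TN\<close>, \<open>\<nabla>\<^sub>X \<nabla>\<^sub>Y Z\<close> is a multiple of
  \<open>g(\<nabla>\<^sub>X Y, Z) + g(Y, \<nabla>\<^sub>X Z) + g(X, \<nabla>\<^sub>Y Z)\<close>, which is symmetric in \<open>X\<close> and \<open>Y\<close>. Multiplying by
  \<open>g(X\<^sub>0, X\<^sub>0)\<close> replaces the mean curvature, whose smoothness is not known, by \<open>\<nabla>\<^sub>X\<^sub>0 X\<^sub>0\<close>.\<close>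

lemma codazzi:
  assumes umb: "totally_umbilical A g D N" and p: "p \<in> U" "p \<in> N"
    and xyz: "x \<in> TN p" "y \<in> TN p" "z \<in> TN p" and orth: "g p x z = 0" "g p y z = 0"
  shows "R p x y z \<in> TN p"
proof (cases "x = 0")
  case True
  have "R p x y z = 0"
    using curvature_operator_scale_left[OF TN_T[OF xyz(1)] TN_T[OF xyz(2)] TN_T[OF xyz(3)], of 0] True by simp
  then show ?thesis using subspace_0[OF subspace_TN[OF p]] by simp
next
  case False
  note xT = TN_T[OF xyz(1)] and yT = TN_T[OF xyz(2)] and zT = TN_T[OF xyz(3)]
  note s = svf_ext[OF c]
  note cp = c p(1)
  let ?X0 = "ext c x" and ?Z = "ext c z"
  let ?g0 = "\<lambda>q. g q (?X0 q) (?X0 q)"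
  \<comment> \<open>The factor by which the identity below is divided; the case x = 0 was split off
    to make it nonzero.\<close>
  have g0: "?g0 p \<noteq> 0" using metric_pos[OF xT False] ext_base[OF cp xT] by simp
  let ?F = "\<lambda>y q. D q (ext c y q) ?Z"
  have F: "svf U (?F y)" for y by (rule D_smooth[OF open_U s s])
  have Dt: "D p v (ext c w) \<in> T p" if "v \<in> T p" for v w by (rule D_tangent[OF open_U s p(1) that])
  have main: "D p x (?F y) (coordf c u) = mean_curvature A g D N p (coordf c u) *
    (g p (D p x (ext c y)) z + g p y (D p x ?Z) + g p x (D p y ?Z))"
    if x: "x \<in> TN p" and y: "y \<in> TN p" and yz: "g p y z = 0" and u: "conormal u" for x y u
  proof -
    note xT = TN_T[OF x] and yT = TN_T[OF y]
    let ?\<phi> = "mean_curvature A g D N p (coordf c u)"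
    let ?D0 = "\<lambda>q. D q (?X0 q) ?X0 (coordf c u)"
    let ?gyz = "\<lambda>q. g q (ext c y q) (?Z q)"
    have near: "smooth_near A p (\<lambda>q. Y q (coordf c u))" if "svf U Y" for Y
      by (rule smooth_near_svf_apply[OF that open_U p(1) smooth_near_coordf[OF cp]])
    have nD0: "smooth_near A p ?D0" by (rule near[OF D_smooth[OF open_U s s]])
    have ng0: "smooth_near A p ?g0" by (rule smooth_nearI[OF metric_smooth[OF open_U s s] open_U p(1)])
    have ngyz: "smooth_near A p ?gyz" by (rule smooth_nearI[OF metric_smooth[OF open_U s s] open_U p(1)])
    \<comment> \<open>Because y is orthogonal to z, umbilicity makes \<open>D p y ?Z\<close> tangent
      to N. Likewise the factors \<open>?F y p (coordf c u)\<close> and \<open>?gyz p\<close> are 0,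
      which removes the derivatives of \<open>?g0\<close> and of \<open>?D0\<close> from the Leibniz
      rule below.\<close>
    have Fp: "D p y ?Z (coordf c u') = 0" if "conormal u'" for u'
      using umbilical_D[OF umb p y xyz(3) p that] yz ext_base[OF cp yT] ext_base[OF cp zT] by simp
    then have FTN: "D p y ?Z \<in> TN p" by (intro TN_I[OF p Dt[OF yT]])
    have D0p: "?D0 p = ?g0 p * ?\<phi>" using umbilical_D[OF umb p xyz(1,1) p u] .
    \<comment> \<open>Along N both products are \<open>?g0 q * ?gyz q\<close> times the component of
      the mean curvature, by \<open>umbilical_D\<close>. All factors shown are smooth, and x is
      tangent to N, so the identity may be differentiated.\<close>
    have "x (\<lambda>q. ?g0 q * ?F y q (coordf c u)) = x (\<lambda>q. ?gyz q * ?D0 q)"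
      by (rule tangent_within_cong[OF x smooth_near_mult[OF ng0 near[OF F]] smooth_near_mult[OF ngyz nD0]
          open_U p(1)])
        (simp add: umbilical_D[OF umb p xyz(1,1) _ _ u] umbilical_D[OF umb p y xyz(3) _ _ u])
    then have "?g0 p * x (\<lambda>q. ?F y q (coordf c u)) = x ?gyz * (?g0 p * ?\<phi>)"
      unfolding tangent_mult[OF xT ng0 near[OF F]] tangent_mult[OF xT ngyz nD0] D0p
      using Fp[OF u] yz by (simp add: ext_base[OF cp yT] ext_base[OF cp zT])
    then have 1: "x (\<lambda>q. ?F y q (coordf c u)) = x ?gyz * ?\<phi>" using g0 by simp
    have 2: "x ?gyz = g p (D p x (ext c y)) z + g p y (D p x ?Z)"
      using metric_compat[OF open_U p(1) s s xT, of y z] by (simp add: ext_base[OF cp yT] ext_base[OF cp zT])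
    \<comment> \<open>Tensoriality replaces the field \<open>?F y\<close> by the constant-component
      extension of its value at p. That value is tangent to N, so \<open>umbilical_D\<close> gives
      the derivative of the extension.\<close>
    have "hess p u x (?F y) = hess p u x (ext c (D p y ?Z))"
      by (rule hess_tensorial[OF p open_U p(1) order_refl xT F s])
        (simp add: ext_base[OF cp yT] ext_base[OF cp Dt[OF yT]])
    also have "x (\<lambda>q. ext c (D p y ?Z) q (coordf c u)) = x (\<lambda>q. 0)"
      by (rule tangent_cong[OF xT near[OF s] smooth_near_const open_U p(1)])
        (simp add: ext_coordf[OF cp Dt[OF yT]] Fp[OF u])
    then have "hess p u x (ext c (D p y ?Z)) = - (g p x (D p y ?Z) * ?\<phi>)"
      using umbilical_D[OF umb p x FTN p u] tangent_const[OF xT, of 0]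
      by (simp add: hess_def[OF p] ext_base[OF cp xT] ext_base[OF cp Dt[OF yT]])
    finally show ?thesis using 1 2 by (simp add: hess_def[OF p] algebra_simps)
  qed
  have RT: "R p x y z \<in> T p" by (rule curvature_operator_tangent[OF xT yT zT])
  show ?thesis
  proof (rule TN_I[OF p RT])
    fix u assume u: "conormal u"
    show "R p x y z (coordf c u) = 0"
      unfolding curvature_operator_ext_D[OF cp xT yT zT]
      using main[OF xyz(1,2) orth(2) u] main[OF xyz(2,1) orth(1) u] D_ext_commute[OF cp xT yT]
      by simp
  qed
qed

end

section \<open>Orthonormal systems and the curvature of planes\<close>

lemma span_pair: "v \<in> span {x, y} \<longleftrightarrow> (\<exists>a b. v = a *\<^sub>R x + b *\<^sub>R y)"
proof
  assume "v \<in> span {x, y}"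
  then obtain a where "v - a *\<^sub>R x \<in> span {y}" using span_breakdown_eq[of v x "{y}"] by blast
  then obtain b where "v - a *\<^sub>R x = b *\<^sub>R y" using span_singleton[of y] by auto
  then have "v = a *\<^sub>R x + b *\<^sub>R y" by (metis diff_add_cancel add.commute)
  then show "\<exists>a b. v = a *\<^sub>R x + b *\<^sub>R y" by blast
next
  show "\<exists>a b. v = a *\<^sub>R x + b *\<^sub>R y \<Longrightarrow> v \<in> span {x, y}"
    by (auto intro: span_add span_scale span_base)
qed

context levi_civita
begin

lemma orthonormal_independent:
  assumes "B \<subseteq> T p" "\<And>a b. a \<in> B \<Longrightarrow> b \<in> B \<Longrightarrow> g p a b = (if a = b then 1 else 0)"
  shows "independent B"
  unfolding dependent_def
proof clarify
  fix a assume a: "a \<in> B" "a \<in> span (B - {a})"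
  have "g p a a = 0"
    by (rule orthogonal_span[OF _ _ _ a(2)]) (use assms a in auto)
  then show False using assms(2)[OF a(1) a(1)] by simp
qed

lemma normalize:
  assumes w: "w \<in> T p" "w \<noteq> 0"
  obtains w' where "w' \<in> T p" "g p w' w' = 1" "w = sqrt (g p w w) *\<^sub>R w'"
    "w' = (1 / sqrt (g p w w)) *\<^sub>R w"
proof -
  have pos: "g p w w > 0" by (rule metric_pos[OF w])
  let ?k = "1 / sqrt (g p w w)"
  have "g p (?k *\<^sub>R w) (?k *\<^sub>R w) = ?k * (?k * g p w w)"
    by (simp only: metric_scale[OF w(1) tangent_closed(3)[OF w(1)]] metric_right(2)[OF w(1) w(1)])
  also have "\<dots> = 1" using pos by (simp add: field_simps)
  finally show ?thesis using that[of "?k *\<^sub>R w"] pos tangent_closed(3)[OF w(1)] by simp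
qed

text \<open>By dimension some v in \<sigma> lies outside the span of S. Its part orthogonal to S is
  nonzero, and it stays in \<sigma> because only a combination of elements of S is
  subtracted.\<close>

lemma unit_orthogonal_exists:
  assumes \<sigma>: "subspace \<sigma>" "\<sigma> \<subseteq> T p" and S: "finite S" "S \<subseteq> \<sigma>" "card S < dim \<sigma>"
  obtains w where "w \<in> \<sigma>" "g p w w = 1" "\<And>s. s \<in> S \<Longrightarrow> g p w s = 0"
proof -
  have "\<not> \<sigma> \<subseteq> span S" using real_vector.dim_le_card[of \<sigma> S] S by auto
  then obtain v where v: "v \<in> \<sigma>" "v \<notin> span S" by blast
  have ST: "S \<subseteq> T p" and vT: "v \<in> T p" using S \<sigma> v by auto
  obtain w where w: "w \<in> T p" "v - w \<in> span S" "\<forall>s\<in>S. g p w s = 0"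
    using orthogonal_projection_exists[OF S(1) ST vT] by blast
  have "span S \<subseteq> \<sigma>" by (rule span_minimal[OF S(2) \<sigma>(1)])
  then have "v - (v - w) \<in> \<sigma>" using subspace_diff[OF \<sigma>(1) v(1)] w(2) by blast
  then have w\<sigma>: "w \<in> \<sigma>" by simp
  have "w \<noteq> 0" using w(2) v(2) by auto
  then obtain w' where w': "g p w' w' = 1" "w' = (1 / sqrt (g p w w)) *\<^sub>R w"
    using normalize[OF w(1)] by metis
  show ?thesis
  proof (rule that[of w'])
    show "w' \<in> \<sigma>" unfolding w'(2) by (rule subspace_scale[OF \<sigma>(1) w\<sigma>])
    show "g p w' s = 0" if "s \<in> S" for s
      unfolding w'(2) using metric_scale[OF w(1), of s] ST that w(3) by auto
  qed (rule w'(1))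
qed

lemma dim_tangent_space: "dim (T p) = DIM('e)"
proof -
  obtain c where c: "c \<in> A" "p \<in> fst c" using atlas_cover .
  note ca = atlas_admissible[OF c(1)] c(2)
  have lin: "linear (coord_vec A c p)" by (rule linear_coord_vec[OF ca])
  have inj: "inj (coord_vec A c p)"
  proof (rule injI)
    fix e e' assume "coord_vec A c p e = coord_vec A c p e'"
    then have "e \<bullet> u = e' \<bullet> u" for u using coord_vec_coordf[OF ca] by metis
    then have "\<forall>u. e \<bullet> u = e' \<bullet> u" by blast
    then show "e = e'" by (rule iffD1[OF vector_eq_rdot])
  qed
  let ?B = "coord_vec A c p ` Basis"
  have "T p = span ?B"
    unfolding tangent_space_eq[OF ca] linear_span_image[OF lin] by simp
  moreover have "independent ?B"
    by (rule linear_independent_injective_image[OF lin independent_Basis]) (rule inj_on_subset[OF inj subset_UNIV])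
  ultimately have "dim (T p) = card ?B"
    using real_vector.dim_span_eq_card_independent by metis
  then show ?thesis using card_image[OF inj_on_subset[OF inj subset_UNIV], of Basis] by simp
qed

abbreviation "Rm \<equiv> curvature A g D"

lemma Rm_scale:
  assumes "x \<in> T p" "y \<in> T p" "z \<in> T p" "u \<in> T p"
  shows "Rm p (a *\<^sub>R x) (b *\<^sub>R y) (k *\<^sub>R z) (l *\<^sub>R u) = a * b * k * l * Rm p x y z u"
proof -
  note t = tangent_closed(3)
  have Rt: "R p x y z \<in> T p" by (rule curvature_operator_tangent[OF assms(1-3)])
  have "R p (a *\<^sub>R x) (b *\<^sub>R y) (k *\<^sub>R z) = (a * b * k) *\<^sub>R R p x y z"
    unfolding curvature_operator_scale_left[OF assms(1) t[OF assms(2)] t[OF assms(3)]]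
      curvature_operator_antisym[OF assms(1) t[OF assms(2)] t[OF assms(3)]]
      curvature_operator_scale_left[OF assms(2,1) t[OF assms(3)]]
      curvature_operator_scale_right[OF assms(2,1,3)] curvature_operator_antisym[OF assms(2,1,3)]
    by (simp add: mult.assoc)
  then show ?thesis
    unfolding curvature_def
    by (simp add: metric_scale[OF Rt t[OF assms(4)]] metric_scale[OF t[OF Rt] t[OF assms(4)]] metric_right(2)[OF assms(4) Rt])
qed

text \<open>An alternating bilinear map changes by the determinant of the coefficients. The target
  is general because the lemma is used for the vector-valued \<open>R p x y z\<close> in x, y and
  for the real-valued \<open>g p (R p x y z) u\<close> in z, u.\<close>

lemma alternating_pair:
  fixes \<omega> :: "'a tvec \<Rightarrow> 'a tvec \<Rightarrow> 'v::real_vector"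
  assumes add: "\<And>x x' y. x \<in> T p \<Longrightarrow> x' \<in> T p \<Longrightarrow> y \<in> T p \<Longrightarrow> \<omega> (x + x') y = \<omega> x y + \<omega> x' y"
    and scale: "\<And>k x y. x \<in> T p \<Longrightarrow> y \<in> T p \<Longrightarrow> \<omega> (k *\<^sub>R x) y = k *\<^sub>R \<omega> x y"
    and anti: "\<And>x y. x \<in> T p \<Longrightarrow> y \<in> T p \<Longrightarrow> \<omega> x y = - \<omega> y x"
    and x: "x \<in> T p" and y: "y \<in> T p"
  shows "\<omega> (a *\<^sub>R x + b *\<^sub>R y) (k *\<^sub>R x + l *\<^sub>R y) = (a * l - b * k) *\<^sub>R \<omega> x y"
proof -
  note t = tangent_closed(3)
  have lin: "\<omega> (a *\<^sub>R x + b *\<^sub>R y) v = a *\<^sub>R \<omega> x v + b *\<^sub>R \<omega> y v" if "v \<in> T p" for a b v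
    using add[OF t[OF x] t[OF y] that] scale[OF x that] scale[OF y that] by simp
  have self: "\<omega> v v = 0" if "v \<in> T p" for v
  proof -
    have "2 *\<^sub>R \<omega> v v = 0" unfolding scaleR_2 using anti[OF that that] eq_neg_iff_add_eq_0 by blast
    then show ?thesis by simp
  qed
  have v: "k *\<^sub>R x + l *\<^sub>R y \<in> T p" by (intro tangent_closed x y)
  have "\<omega> x (k *\<^sub>R x + l *\<^sub>R y) = l *\<^sub>R \<omega> x y"
    using anti[OF x v] lin[OF x, of k l] self[OF x] anti[OF x y] by simp
  moreover have "\<omega> y (k *\<^sub>R x + l *\<^sub>R y) = - (k *\<^sub>R \<omega> x y)"
    using anti[OF y v] lin[OF y, of k l] self[OF y] by simp
  ultimately show ?thesis unfolding lin[OF v] by (simp add: scaleR_diff_left)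
qed

text \<open>Each of the two antisymmetric pairs of arguments contributes one factor of the
  determinant.\<close>

lemma Rm_pair:
  fixes a b k l :: real
  assumes x: "x \<in> T p" and y: "y \<in> T p"
  defines "x' \<equiv> a *\<^sub>R x + b *\<^sub>R y" and "y' \<equiv> k *\<^sub>R x + l *\<^sub>R y"
  shows "Rm p x' y' x' y' = (a * l - b * k)\<^sup>2 * Rm p x y x y"
proof -
  have x': "x' \<in> T p" "y' \<in> T p" unfolding x'_def y'_def by (intro tangent_closed x y)+
  have 1: "R p x' y' z = (a * l - b * k) *\<^sub>R R p x y z" if z: "z \<in> T p" for z
    unfolding x'_def y'_def
    by (rule alternating_pair[where p = p and \<omega> = "\<lambda>x y. R p x y z"])
      (assumption | rule x y z curvature_operator_add_left curvature_operator_scale_left curvature_operator_antisym)+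
  have "g p (R p x y x') y' = (a * l - b * k) *\<^sub>R g p (R p x y x) y"
    unfolding x'_def y'_def
  proof (rule alternating_pair[where p = p and \<omega> = "\<lambda>z u. g p (R p x y z) u"])
    note Rt = curvature_operator_tangent[OF x y]
    fix z z' u k assume z: "z \<in> T p" and u: "u \<in> T p"
    show "g p (R p x y (k *\<^sub>R z)) u = k *\<^sub>R g p (R p x y z) u"
      by (simp add: curvature_operator_scale_right[OF x y z] metric_scale[OF Rt[OF z] u])
    show "g p (R p x y z) u = - g p (R p x y u) z" by (rule curvature_antisym_right[OF x y z u])
    assume z': "z' \<in> T p"
    show "g p (R p x y (z + z')) u = g p (R p x y z) u + g p (R p x y z') u"
      by (simp add: curvature_operator_add_right[OF x y z z'] metric_add[OF Rt[OF z] Rt[OF z'] u])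
  qed (rule x y)+
  then show ?thesis
    unfolding curvature_def 1[OF x'(1)] metric_scale[OF curvature_operator_tangent[OF x y x'(1)] x'(2)]
    by (simp add: power2_eq_square)
qed

lemma Rm_orthonormal_pair:
  assumes x: "x \<in> T p" "y \<in> T p" and on: "orthonormal_pair g p x y" "orthonormal_pair g p x' y'"
    and x': "x' \<in> span {x, y}" "y' \<in> span {x, y}"
  shows "Rm p x' y' x' y' = Rm p x y x y"
proof -
  obtain a b k l where eq: "x' = a *\<^sub>R x + b *\<^sub>R y" "y' = k *\<^sub>R x + l *\<^sub>R y"
    using x' unfolding span_pair by blast
  have xy: "g p x x = 1" "g p y y = 1" "g p x y = 0" "g p y x = 0"
    using on(1) metric_sym[OF x] by (auto simp: orthonormal_pair_def)
  have gg: "g p (a *\<^sub>R x + b *\<^sub>R y) (k *\<^sub>R x + l *\<^sub>R y) = a * k + b * l" for a b k l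
  proof -
    have t: "a *\<^sub>R x \<in> T p" "b *\<^sub>R y \<in> T p" "k *\<^sub>R x \<in> T p" "l *\<^sub>R y \<in> T p" "k *\<^sub>R x + l *\<^sub>R y \<in> T p"
      by (intro tangent_closed x)+
    show ?thesis
      by (simp add: metric_add[OF t(1,2,5)] metric_scale[OF x(1) t(5)] metric_scale[OF x(2) t(5)]
          metric_right(1)[OF t(3,4) x(1)] metric_right(1)[OF t(3,4) x(2)] metric_right(2)[OF x(1) x(1)]
          metric_right(2)[OF x(2) x(1)] metric_right(2)[OF x(1) x(2)] metric_right(2)[OF x(2) x(2)] xy)
  qed
  have n: "a * a + b * b = 1" "k * k + l * l = 1" "a * k + b * l = 0"
    using on(2) unfolding orthonormal_pair_def eq gg by auto
  \<comment> \<open>Lagrange's identity: between orthonormal pairs the determinant is 1 or -1. Hence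
    the sectional curvature does not depend on the chosen pair.\<close>
  have "(a * l - b * k)\<^sup>2 = (a * a + b * b) * (k * k + l * l) - (a * k + b * l)\<^sup>2"
    by (simp add: power2_eq_square algebra_simps)
  then have "(a * l - b * k)\<^sup>2 = 1" by (simp add: n)
  then show ?thesis unfolding eq Rm_pair[OF x] by simp
qed

end

section \<open>Almost Hermitian structures\<close>

locale almost_hermitian = levi_civita A g D
  for A :: "('a::{t2_space, second_countable_topology}, 'e::euclidean_space) chart set"
    and g :: "'a metric" and D :: "'a connection_op" +
  fixes J :: "'a endo_field"
  assumes J_structure: "almost_complex_structure A J"
    and J_isometry: "x \<in> T p \<Longrightarrow> y \<in> T p \<Longrightarrow> g p (J p x) (J p y) = g p x y"
begin

lemmas J_axioms = J_structure[unfolded almost_complex_structure_def]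

lemmas J_T = J_axioms[THEN conjunct1, rule_format, THEN conjunct1]
  and J_J = J_axioms[THEN conjunct1, rule_format, THEN conjunct2]
  and J_add = J_axioms[THEN conjunct2, THEN conjunct1, rule_format, THEN conjunct1]

lemma J_scale: "x \<in> T p \<Longrightarrow> J p (k *\<^sub>R x) = k *\<^sub>R J p x"
  by (rule J_axioms[THEN conjunct2, THEN conjunct1, rule_format, THEN conjunct2])

lemma J_zero: "J p 0 = 0"
  using J_scale[OF tangent_closed(5), of p 0] by simp

lemma J_skew:
  assumes "x \<in> T p" "y \<in> T p"
  shows "g p (J p x) y = - g p x (J p y)"
  using J_isometry[OF J_T[OF assms(1)] assms(2)] J_J[OF assms(1)] metric_minus(1)[OF assms(1) J_T[OF assms(2)]] by simp

lemma J_self: "x \<in> T p \<Longrightarrow> g p x (J p x) = 0"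
  using J_skew[of x p x] metric_sym[OF _ J_T, of x p x] by simp

lemma J_span:
  assumes B: "B \<subseteq> T p" "\<And>b. b \<in> B \<Longrightarrow> J p b \<in> span B" and v: "v \<in> span B"
  shows "J p v \<in> span B"
proof -
  have "span B \<subseteq> {v \<in> T p. J p v \<in> span B}"
  proof (rule span_minimal)
    show "subspace {v \<in> T p. J p v \<in> span B}"
      by (rule subspaceI) (auto simp: tangent_closed J_zero J_add J_scale span_zero span_add span_scale)
  qed (use B in auto)
  then show ?thesis using v by blast
qed

text \<open>An orthonormal basis of a holomorphic plane. Invariance is asked of the span, not of B:
  J sends Jw to -w, which an orthonormal set containing w cannot contain.\<close>

definition unitary_frame :: "'a \<Rightarrow> 'a tvec set \<Rightarrow> bool"
  where "unitary_frame p B \<longleftrightarrow> finite B \<and> B \<subseteq> T p \<and> (\<forall>b\<in>B. J p b \<in> span B) \<and>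
    (\<forall>a\<in>B. \<forall>b\<in>B. g p a b = (if a = b then 1 else 0))"

lemma unitary_frame_insert:
  assumes B: "unitary_frame p B" and w: "w \<in> T p" "g p w w = 1" "\<And>b. b \<in> B \<Longrightarrow> g p w b = 0"
  shows "unitary_frame p (insert w (insert (J p w) B))" "card (insert w (insert (J p w) B)) = card B + 2"
proof -
  let ?B = "insert w (insert (J p w) B)"
  have fin: "finite B" and BT: "B \<subseteq> T p" and JB: "\<And>b. b \<in> B \<Longrightarrow> J p b \<in> span B"
    and on: "\<And>a b. a \<in> B \<Longrightarrow> b \<in> B \<Longrightarrow> g p a b = (if a = b then 1 else 0)"
    using B by (auto simp: unitary_frame_def)
  have Jw: "J p w \<in> T p" by (rule J_T[OF w(1)])
  have Jw1: "g p (J p w) (J p w) = 1" using J_isometry[OF w(1) w(1)] w(2) by simp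
  have wJ: "g p w (J p w) = 0" by (rule J_self[OF w(1)])
  \<comment> \<open>J is skew, so this is minus the product of w with \<open>J p b\<close>, which
    lies in \<open>span B\<close>, to which w is orthogonal.\<close>
  have Jwb: "g p (J p w) b = 0" if "b \<in> B" for b
    using J_skew[OF w(1), of b] orthogonal_span[OF w(1) BT w(3) JB[OF that]] BT that by auto
  have sym: "g p b w = 0" "g p b (J p w) = 0" if "b \<in> B" for b
    using metric_sym[OF w(1), of b] metric_sym[OF Jw, of b] w(3)[OF that] Jwb[OF that] BT that by auto
  have Jw_w: "g p (J p w) w = 0" using metric_sym[OF w(1) Jw] wJ by simp
  have ne: "w \<noteq> J p w" "w \<notin> B" "J p w \<notin> B"
    using w(2) wJ w(3)[of w] Jw1 Jwb[of "J p w"] by auto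
  then show "card ?B = card B + 2" using fin by simp
  have mono: "span B \<subseteq> span ?B" by (rule span_mono) auto
  have "J p b \<in> span ?B" if "b \<in> ?B" for b
  proof -
    have "- w \<in> span ?B" by (rule span_neg[OF span_base]) simp
    then show ?thesis using that JB mono J_J[OF w(1)] span_base[of "J p w" ?B] by auto
  qed
  moreover have "g p a b = (if a = b then 1 else 0)" if "a \<in> ?B" "b \<in> ?B" for a b
    using that w(2,3) Jw1 wJ Jw_w Jwb sym on ne by auto
  ultimately show "unitary_frame p ?B"
    unfolding unitary_frame_def using fin BT w(1) Jw by blast
qed

text \<open>The frame starts as x, Jx and grows by pairs w, Jw with w a unit vector orthogonal to y,
  Jy and the frame so far; J being a skew isometry, Jw is then orthogonal to y and Jy too.\<close>

lemma unitary_frame_exists: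
  assumes dim: "DIM('e) = 2 * m" and x: "x \<in> T p" "g p x x = 1"
    and y: "y \<in> T p" "g p x y = 0" "g p x (J p y) = 0"
    and n: "1 \<le> n" "n \<le> m - 1"
  shows "\<exists>B. unitary_frame p B \<and> card B = 2 * n \<and> x \<in> B \<and> (\<forall>b\<in>B. g p b y = 0 \<and> g p b (J p y) = 0)"
  using n
proof (induction n rule: dec_induct)
  case base
  have "unitary_frame p {}" by (simp add: unitary_frame_def)
  note f = unitary_frame_insert[OF this x]
  have "g p (J p x) y = 0" "g p (J p x) (J p y) = 0"
    using J_skew[OF x(1) y(1)] J_isometry[OF x(1) y(1)] y by auto
  then show ?case using f y by (intro exI[of _ "{x, J p x}"]) auto
next
  case (step n)
  then obtain B where B: "unitary_frame p B" "card B = 2 * n" "x \<in> B" "\<And>b. b \<in> B \<Longrightarrow> g p b y = 0 \<and> g p b (J p y) = 0"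
    by auto
  let ?S = "insert y (insert (J p y) B)"
  have Jy: "J p y \<in> T p" by (rule J_T[OF y(1)])
  have fin: "finite B" "B \<subseteq> T p" using B(1) by (auto simp: unitary_frame_def)
  have "card ?S \<le> 2 * n + 2"
    using card_insert_le_m1[of "2 * n + 2" "insert (J p y) B" y] card_insert_le_m1[of "2 * n + 1" B "J p y"] B(2) by simp
  \<comment> \<open>Room for w: the premise of the step is \<open>Suc n \<le> m - 1\<close>, so 2n +
    2, with y and Jy counted, is below 2m.\<close>
  also have "\<dots> < dim (T p)" using step.prems dim by (simp add: dim_tangent_space)
  finally have card: "card ?S < dim (T p)" .
  obtain w where w: "w \<in> T p" "g p w w = 1" "\<And>s. s \<in> ?S \<Longrightarrow> g p w s = 0"
    using unit_orthogonal_exists[OF subspace_tangent_space order_refl, of ?S p] fin y(1) Jy card by auto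
  have "g p (J p w) y = 0" "g p (J p w) (J p y) = 0"
    using J_skew[OF w(1) y(1)] J_isometry[OF w(1) y(1)] w(3) by auto
  then have orth: "g p b y = 0 \<and> g p b (J p y) = 0" if "b \<in> insert w (insert (J p w) B)" for b
    using that B(4) w(3) by auto
  have wB: "g p w b = 0" if "b \<in> B" for b using w(3) that by auto
  note f = unitary_frame_insert[OF B(1) w(1,2) wB]
  show ?case using f B(2,3) orth by (intro exI[of _ "insert w (insert (J p w) B)"]) auto
qed

lemma Rm_JJ_zero:
  assumes dim: "DIM('e) = 2 * m" and n: "1 \<le> n" "n \<le> m - 1"
    and spheres: "co_holomorphic_spheres_axiom A g J D n"
    and x: "x \<in> T p" "y \<in> T p" and on: "orthonormal_pair g p x y" "g p x (J p y) = 0"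
  shows "Rm p x y (J p x) (J p y) = 0"
proof -
  have g: "g p x x = 1" "g p y y = 1" "g p x y = 0" using on(1) by (auto simp: orthonormal_pair_def)
  obtain B where B: "unitary_frame p B" "card B = 2 * n" "x \<in> B"
    and By: "\<And>b. b \<in> B \<Longrightarrow> g p b y = 0" "\<And>b. b \<in> B \<Longrightarrow> g p b (J p y) = 0"
    using unitary_frame_exists[OF dim x(1) g(1) x(2) g(3) on(2) n] by auto
  have fin: "finite B" and BT: "B \<subseteq> T p" and JB: "\<And>b. b \<in> B \<Longrightarrow> J p b \<in> span B"
    and Bon: "\<And>a b. a \<in> B \<Longrightarrow> b \<in> B \<Longrightarrow> g p a b = (if a = b then 1 else 0)"
    using B(1) by (auto simp: unitary_frame_def)
  have Jx: "J p x \<in> T p" and Jy: "J p y \<in> T p" using x by (auto intro: J_T)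
  let ?V = "span B" and ?B' = "insert y B"
  have yB: "y \<notin> B" using By(1)[of y] g(2) by auto
  have B'T: "?B' \<subseteq> T p" using BT x by auto
  have By': "g p y b = 0" if "b \<in> B" for b using metric_sym[OF x(2), of b] By(1)[OF that] BT that by auto
  have B'on: "g p a b = (if a = b then 1 else 0)" if "a \<in> ?B'" "b \<in> ?B'" for a b
    using that Bon By(1) By' g(2) yB by auto
  have dimV: "dim ?V = 2 * n"
    using real_vector.dim_span_eq_card_independent[OF orthonormal_independent[OF BT Bon]] B(2) by simp
  have dimV': "dim (span ?B') = 2 * n + 1"
    using real_vector.dim_span_eq_card_independent[OF orthonormal_independent[OF B'T B'on]] B(2) yB fin by simp
  have VT: "?V \<subseteq> T p" by (rule span_tangent[OF BT])
  have "J p ` ?V = ?V"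
  proof (intro equalityI subsetI)
    show "v \<in> ?V" if "v \<in> J p ` ?V" for v using that J_span[OF BT JB] by auto
    fix v assume v: "v \<in> ?V"
    have "J p (J p (- v)) = v" using J_J[of "- v" p] tangent_closed(4)[of v p] v VT by auto
    moreover have "J p (- v) \<in> ?V" by (rule J_span[OF BT JB span_neg[OF v]])
    ultimately show "v \<in> J p ` ?V" by (metis imageI)
  qed
  then have "holomorphic_plane A J n p ?V"
    unfolding holomorphic_plane_def using VT dimV subspace_span by blast
  moreover have "?V \<subseteq> span ?B'" by (rule span_mono) auto
  ultimately have "co_holomorphic_plane A J n p (span ?B')"
    unfolding co_holomorphic_plane_def using span_tangent[OF B'T] dimV' subspace_span by blast
  then obtain N where N: "submanifold A (2 * n + 1) N" "totally_umbilical A g D N" "p \<in> N"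
    "tangent_space_within A N p = span ?B'"
    using spheres unfolding co_holomorphic_spheres_axiom_def by blast
  obtain c L where ch: "admissible_chart A c" "p \<in> fst c" and sl: "subspace L" "snd c ` (fst c \<inter> N) = snd c ` fst c \<inter> L"
    using N(1,3) unfolding submanifold_def by blast
  interpret slice A g D c L N by unfold_locales (rule ch sl)+
  have mem: "x \<in> TN p" "y \<in> TN p" "J p x \<in> TN p"
    unfolding N(4) using B(3) subsetD[OF \<open>?V \<subseteq> span ?B'\<close> JB[OF B(3)]] by (simp_all add: span_base)
  \<comment> \<open>The third argument of \<open>codazzi\<close> will be \<open>J p x\<close>, which
    has to be orthogonal to both x and y; this is where g(x,Jy) = 0 enters.\<close>
  have "g p y (J p x) = - g p (J p y) x" using J_skew[OF x(2,1)] by simp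
  also have "\<dots> = 0" using metric_sym[OF x(1) Jy] on(2) by simp
  finally have "g p y (J p x) = 0" .
  then have R: "R p x y (J p x) \<in> span ?B'"
    using codazzi[OF N(2) ch(2) N(3) mem J_self[OF x(1)]] unfolding N(4) by simp
  have "g p (J p y) s = 0" if "s \<in> ?B'" for s
    using that metric_sym[OF Jy, of s] By(2)[of s] J_self[OF x(2)] B'T by auto
  then have "g p (J p y) (R p x y (J p x)) = 0"
    by (rule orthogonal_span[OF Jy B'T _ R])
  then show ?thesis
    unfolding curvature_def using metric_sym[OF Jy curvature_operator_tangent[OF x Jx]] by simp
qed

section \<open>Anti-holomorphic planes and the type function\<close>

lemma plane_orthonormal_pair:
  assumes "plane_section A p \<sigma>"
  obtains x y where "x \<in> \<sigma>" "y \<in> \<sigma>" "orthonormal_pair g p x y"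
proof -
  have \<sigma>: "subspace \<sigma>" "\<sigma> \<subseteq> T p" "dim \<sigma> = 2" using assms by (auto simp: plane_section_def)
  obtain x where x: "x \<in> \<sigma>" "g p x x = 1" 
    using unit_orthogonal_exists[OF \<sigma>(1,2), of "{}"] \<sigma>(3) by auto
  obtain y where y: "y \<in> \<sigma>" "g p y y = 1" "g p y x = 0"
    using unit_orthogonal_exists[OF \<sigma>(1,2), of "{x}"] \<sigma>(3) x(1) by auto
  have "g p x y = 0" using metric_sym[of x p y] x y \<sigma>(2) by auto
  then show ?thesis using that x y by (simp add: orthonormal_pair_def)
qed

lemma sectional_curvature_span:
  assumes x: "x \<in> T p" "y \<in> T p" and on: "orthonormal_pair g p x y"
  shows "sectional_curvature A g D p (span {x, y}) = Rm p x y x y"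
  unfolding sectional_curvature_def
proof (rule the_equality)
  show "\<forall>x'\<in>span {x, y}. \<forall>y'\<in>span {x, y}. orthonormal_pair g p x' y' \<longrightarrow> Rm p x y x y = Rm p x' y' x' y'"
    using Rm_orthonormal_pair[OF x on] by auto
qed (use on span_base[of x "{x, y}"] span_base[of y "{x, y}"] in blast)

lemma anti_holomorphic_span:
  assumes x: "x \<in> T p" "y \<in> T p" and on: "orthonormal_pair g p x y" "g p x (J p y) = 0"
  shows "anti_holomorphic A g J p (span {x, y})"
proof -
  have g: "g p x x = 1" "g p y y = 1" "g p x y = 0" "g p y x = 0"
    using on(1) metric_sym[OF x] by (auto simp: orthonormal_pair_def)
  have ne: "x \<noteq> y" using g by auto
  have sub: "{x, y} \<subseteq> T p" using x by simp
  have "g p a b = (if a = b then 1 else 0)" if "a \<in> {x, y}" "b \<in> {x, y}" for a b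
    using that g ne by auto
  then have "dim (span {x, y}) = 2"
    using real_vector.dim_span_eq_card_independent[OF orthonormal_independent[OF sub]] ne by simp
  then have 1: "plane_section A p (span {x, y})"
    unfolding plane_section_def using span_tangent[OF sub] subspace_span by blast
  have Jx: "J p x \<in> T p" and Jy: "J p y \<in> T p" using x by (auto intro: J_T)
  have z: "g p (J p x) x = 0" "g p (J p x) y = 0" "g p (J p y) x = 0" "g p (J p y) y = 0"
    using J_skew[OF x(1,1)] J_skew[OF x] J_skew[OF x(2,1)] J_skew[OF x(2,2)] J_self[OF x(1)] J_self[OF x(2)]
      on(2) metric_sym[OF Jy x(1)] by auto
  have "g p (J p v) w = 0" if vw: "v \<in> span {x, y}" "w \<in> span {x, y}" for v w
  proof -
    obtain a b where v: "v = a *\<^sub>R x + b *\<^sub>R y" using vw(1) unfolding span_pair by blast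
    have Jv: "J p v = a *\<^sub>R J p x + b *\<^sub>R J p y"
      unfolding v using J_add[OF tangent_closed(3)[OF x(1)] tangent_closed(3)[OF x(2)]] J_scale[OF x(1)] J_scale[OF x(2)] by simp
    have t: "a *\<^sub>R J p x \<in> T p" "b *\<^sub>R J p y \<in> T p" by (intro tangent_closed Jx Jy)+
    have *: "g p (J p v) s = 0" if "s \<in> {x, y}" for s
      unfolding Jv using that x z
      by (auto simp: metric_add[OF t] metric_scale[OF Jx] metric_scale[OF Jy])
    have "J p v \<in> T p" unfolding Jv by (rule tangent_closed(1)[OF t])
    then show ?thesis by (rule orthogonal_span[OF _ sub * vw(2)])
  qed
  then show ?thesis unfolding anti_holomorphic_def using 1 by blast
qed

lemma type_function_scale:
  assumes "x \<in> T p" "y \<in> T p"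
  shows "type_function A g J D p (a *\<^sub>R x) (b *\<^sub>R y) = a\<^sup>2 * b\<^sup>2 * type_function A g J D p x y"
  unfolding type_function_def J_scale[OF assms(1)] J_scale[OF assms(2)]
    Rm_scale[OF assms assms] Rm_scale[OF assms J_T[OF assms(1)] J_T[OF assms(2)]]
  by (simp add: power2_eq_square algebra_simps)

context
  fixes p :: 'a and \<alpha>p :: real
  assumes type: "\<And>x y. x \<in> T p \<Longrightarrow> y \<in> T p \<Longrightarrow> orthonormal_pair g p x y \<Longrightarrow> g p x (J p y) = 0 \<Longrightarrow>
    type_function A g J D p x y = \<alpha>p"
begin

text \<open>The hypothesis concerns orthonormal pairs, whereas \<open>constant_type_at\<close>
  admits vectors of any length, zero included. The type function has degree two in each argument,
  since J is linear, so its value depends on y only through the length of y.\<close>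

lemma type_function_norm:
  assumes x: "x \<in> T p" "y \<in> T p" and orth: "g p x y = 0" "g p (J p x) y = 0"
  shows "type_function A g J D p x y = g p x x * g p y y * \<alpha>p"
proof (cases "x = 0 \<or> y = 0")
  case True
  have "type_function A g J D p 0 y = 0" "type_function A g J D p x 0 = 0"
    using type_function_scale[OF x, of 0 1] type_function_scale[OF x, of 1 0] by auto
  then show ?thesis using True metric_zero[OF tangent_closed(5)] by auto
next
  case False
  obtain x' where x': "x' \<in> T p" "g p x' x' = 1" "x = sqrt (g p x x) *\<^sub>R x'" "x' = (1 / sqrt (g p x x)) *\<^sub>R x"
    using normalize[OF x(1)] False by blast
  obtain y' where y': "y' \<in> T p" "g p y' y' = 1" "y = sqrt (g p y y) *\<^sub>R y'" "y' = (1 / sqrt (g p y y)) *\<^sub>R y"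
    using normalize[OF x(2)] False by blast
  have "g p x' y' = 0"
    unfolding x'(4) y'(4) metric_scale[OF x(1) tangent_closed(3)[OF x(2)]] metric_right(2)[OF x(2,1)] orth by simp
  moreover have "g p x' (J p y') = 0"
    unfolding x'(4) y'(4) J_scale[OF x(2)] metric_scale[OF x(1) tangent_closed(3)[OF J_T[OF x(2)]]]
      metric_right(2)[OF J_T[OF x(2)] x(1)] using J_skew[OF x] orth(2) by simp
  ultimately have t: "type_function A g J D p x' y' = \<alpha>p"
    using type[OF x'(1) y'(1)] x'(2) y'(2) by (simp add: orthonormal_pair_def)
  have pos: "g p x x > 0" "g p y y > 0" using False metric_pos x by auto
  have "type_function A g J D p x y = (sqrt (g p x x))\<^sup>2 * (sqrt (g p y y))\<^sup>2 * \<alpha>p"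
    using type_function_scale[OF x'(1) y'(1), of "sqrt (g p x x)" "sqrt (g p y y)"]
    unfolding x'(3)[symmetric] y'(3)[symmetric] t .
  then show ?thesis using pos by simp
qed

lemma constant_type_atI: "constant_type_at A g J D p"
  unfolding constant_type_at_def using type_function_norm by simp

end

lemma type_iff_anti_holomorphic:
  assumes zero: "\<And>p x y. x \<in> T p \<Longrightarrow> y \<in> T p \<Longrightarrow> orthonormal_pair g p x y \<Longrightarrow> g p x (J p y) = 0 \<Longrightarrow>
    Rm p x y (J p x) (J p y) = 0"
  shows "pointwise_constant_type A g J D \<alpha> \<longleftrightarrow> pointwise_constant_anti_holomorphic_curvature A g J D \<alpha>"
proof
  have type: "type_function A g J D p x y = Rm p x y x y"
    if "x \<in> T p" "y \<in> T p" "orthonormal_pair g p x y" "g p x (J p y) = 0" for p x y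
    using zero[OF that] by (simp add: type_function_def)
  {
    assume L: "pointwise_constant_type A g J D \<alpha>"
    show "pointwise_constant_anti_holomorphic_curvature A g J D \<alpha>"
      unfolding pointwise_constant_anti_holomorphic_curvature_def
    proof (intro allI impI)
      fix p \<sigma> assume ah: "anti_holomorphic A g J p \<sigma>"
      then have \<sigma>: "plane_section A p \<sigma>" "\<sigma> \<subseteq> T p" by (auto simp: anti_holomorphic_def plane_section_def)
      have *: "\<alpha> p = Rm p x y x y" if xy: "x \<in> \<sigma>" "y \<in> \<sigma>" "orthonormal_pair g p x y" for x y
      proof -
        have T: "x \<in> T p" "y \<in> T p" using xy \<sigma>(2) by auto
        have "g p x (J p y) = 0"
          using ah xy metric_sym[OF T(1) J_T[OF T(2)]] by (simp add: anti_holomorphic_def)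
        then show ?thesis using L T xy(3) type[OF T xy(3)] unfolding pointwise_constant_type_def by auto
      qed
      show "sectional_curvature A g D p \<sigma> = \<alpha> p"
        unfolding sectional_curvature_def
      proof (rule the_equality)
        show "\<forall>x\<in>\<sigma>. \<forall>y\<in>\<sigma>. orthonormal_pair g p x y \<longrightarrow> \<alpha> p = Rm p x y x y" using * by blast
        fix k assume k: "\<forall>x\<in>\<sigma>. \<forall>y\<in>\<sigma>. orthonormal_pair g p x y \<longrightarrow> k = Rm p x y x y"
        \<comment> \<open>An orthonormal pair in \<sigma> is what makes the description in
          \<open>sectional_curvature\<close> determine its value; without one every k would
          qualify.\<close>
        obtain x y where "x \<in> \<sigma>" "y \<in> \<sigma>" "orthonormal_pair g p x y" using plane_orthonormal_pair[OF \<sigma>(1)] .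
        then show "k = \<alpha> p" using * k by metis
      qed
    qed
  }
  {
    assume Rt: "pointwise_constant_anti_holomorphic_curvature A g J D \<alpha>"
    have *: "type_function A g J D p x y = \<alpha> p"
      if xy: "x \<in> T p" "y \<in> T p" "orthonormal_pair g p x y" "g p x (J p y) = 0" for p x y
      using Rt anti_holomorphic_span[OF xy] sectional_curvature_span[OF xy(1-3)] type[OF xy]
      unfolding pointwise_constant_anti_holomorphic_curvature_def by auto
    show "pointwise_constant_type A g J D \<alpha>"
      unfolding pointwise_constant_type_def using constant_type_atI[OF *] * by blast
  }
qed

end

theorem theorem4p1:
  fixes A :: "('a::{t2_space, second_countable_topology}, 'e::euclidean_space) chart set"
    and g :: "'a metric" and J :: "'a endo_field" and D :: "'a connection_op"
    and m n :: nat and \<alpha> :: "'a \<Rightarrow> real"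
  assumes "almost_hermitian_manifold A g J"
    and "connected (UNIV :: 'a set)"
    and "DIM('e) = 2 * m" and "2 * m \<ge> 6"
    and "levi_civita_connection A g D"
    and "1 \<le> n" and "n \<le> m - 1"
    and "co_holomorphic_spheres_axiom A g J D n"
  shows "pointwise_constant_type A g J D \<alpha> \<longleftrightarrow>
    pointwise_constant_anti_holomorphic_curvature A g J D \<alpha>"
proof -
  interpret almost_hermitian A g D J
    using assms(1,5) by unfold_locales (auto simp: almost_hermitian_manifold_def)
  show ?thesis
    by (rule type_iff_anti_holomorphic, rule Rm_JJ_zero[OF assms(3,6,7,8)])
qed

end
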